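(* Let $d\ge2$ be an integer and $r\in(0,\infty)$. With the sets $D_T$ ($T\in\mathscr T_r$) and functions $\chi_r^\alpha$ ($\alpha\in r\mathbb Z^d$) defined in the context, $\{D_T\mid T\in\mathscr T_r\}$ is a partition of $\mathbb R^d$ and $(\chi_r^\alpha)_{\alpha\in r\mathbb Z^d}$ is a partition of unity on $\mathbb R^d$ (i.e. $\sum_\alpha\chi_r^\alpha=1$), with the following properties. (i) $\int_{\mathbb R^d}\chi_r^\alpha\,dx=r^d$ for $\alpha\in r\mathbb Z^d$. (ii) For $\alpha\in r\mathbb Z^d$ the function $\chi_r^\alpha$ is continuous on $\mathbb R^d$ with values in $[0,1]$ and support in $\alpha+[-r,r]^d$. (iii) Let $w=(w_\alpha)_{\alpha\in r\mathbb Z^d}$ be a family of real numbers. For $i=1,\dots,d$ the $i$-th weak partial derivative of $\sum_\alpha w_\alpha\chi_r^\alpha$ is given Lebesgue-a.e. by $$\sum_{\alpha\in r\mathbb Z^d}w_\alpha\,\partial_i\chi_r^\alpha=\frac1r\sum_{\alpha\in r\mathbb Z^d}\ \sum_{\substack{T\in\mathscr T_r:\\ T(\sigma_T^{-1}(i)-1)=\alpha}}(w_{\alpha+re_i}-w_\alpha)\,\mathbf 1_{D_T},$$ and the squared norm of the weak gradient is given Lebesgue-a.e. by $$\sum_{i=1}^d\Big(\sum_{\alpha\in r\mathbb Z^d}w_\alpha\,\partial_i\chi_r^\alpha\Big)^2=\frac1{r^2}\sum_{T\in\mathscr T_r}\mathbf 1_{D_T}\sum_{i=1}^d\big(w_{T(i)}-w_{T(i-1)}\big)^2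 .$$
   Context: $e_1,\dots,e_d$ are the unit vectors of $\mathbb R^d$. $\mathscr T_1^0$ is the set of maps $T:\{0,\dots,d\}\to\{0,1\}^d$ of the form $T(i)=\sum_{j=1}^ie_{\sigma(j)}$ for a permutation $\sigma=\sigma_T$ of $\{1,\dots,d\}$ (shortest edge paths from $0$ to $(1,\dots,1)$ in the unit cube); $T\leftrightarrow\sigma_T$ is a bijection. For a permutation $\sigma$ and $i\in\{2,\dots,d\}$, $<_{\sigma,i}$ denotes the relation $<$ on $\mathbb R$ if $\sigma(i-1)<\sigma(i)$ and $\le$ if $\sigma(i-1)>\sigma(i)$. For $T\in\mathscr T_1^0$, $$D_T=\{x\in\mathbb R^d\mid 0\le x_{\sigma_T(d)}<_{\sigma_T,d}x_{\sigma_T(d-1)}<_{\sigma_T,d-1}\dots<_{\sigma_T,2}x_{\sigma_T(1)}<1\}.$$ For $T\in\mathscr T_1^0$ and $i\in\{0,\dots,d\}$ let $H_T^0(x)=1-x_{\sigma_T(1)}$, $H_T^i(x)=x_{\sigma_T(i)}-x_{\sigma_T(i+1)}$ for $1\le i\le d-1$, $H_T^d(x)=x_{\sigma_T(d)}$. The primal tent function is $$\chi_1^0(x)=\sum_{T\in\mathscr T_1^0}\sum_{i=0}^d\mathbf 1_{D_T}(x+T(i))\,H_T^i(x+T(i)),$$ and $\chi_r^\alpha(x)=\chi_1^0((x-\alpha)/r)$ for $r>0$, $\alpha\in r\mathbb Z^d$. Finally $\mathscr T_r$ is the set of maps $T=\alpha+rT'$, i.e. $T(i)=\alpha+rT'(i)$,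 with $\alpha\in r\mathbb Z^d$, $T'\in\mathscr T_1^0$; for such $T$ put $D_T=\alpha+rD_{T'}$ and $\sigma_T=\sigma_{T'}$. *)

theory Defs
  imports "HOL-Analysis.Analysis"
begin

text \<open>
  The space is \<open>real ^ 'n\<close> with \<open>d = CARD('n)\<close>. The index type is finite and linearly ordered, so
  its elements, in increasing order, play the role of the coordinate indices \<open>1, \<dots>, d\<close>. Positions
  along a path remain natural numbers. A permutation of \<open>{1, \<dots>, d}\<close> is thus a bijection from
  \<open>{1..d}\<close> to \<open>'n\<close>. Permutations and paths are maps on \<open>{1..d}\<close> and \<open>{0..d}\<close>, hence
  extensional functions, so that equality of HOL functions is equality of maps.
\<close>

definition perms :: "(nat \<Rightarrow> 'n::finite) set" where
  "perms = {\<sigma> \<in> extensional {1..CARD('n)}. bij_betw \<sigma> {1..CARD('n)} UNIV}"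

definition unit_path :: "(nat \<Rightarrow> 'n::finite) \<Rightarrow> nat \<Rightarrow> real ^ 'n" where
  "unit_path \<sigma> = restrict (\<lambda>i. \<Sum>j=1..i. axis (\<sigma> j) 1) {0..CARD('n)}"

definition unit_paths :: "(nat \<Rightarrow> real ^ 'n::finite) set" where
  "unit_paths = unit_path ` perms"

definition unit_perm :: "(nat \<Rightarrow> real ^ 'n) \<Rightarrow> nat \<Rightarrow> 'n::finite" where
  "unit_perm = the_inv_into perms unit_path"

definition less_perm :: "(nat \<Rightarrow> 'n::{finite,linorder}) \<Rightarrow> nat \<Rightarrow> real \<Rightarrow> real \<Rightarrow> bool" where
  "less_perm \<sigma> i a b \<longleftrightarrow> (if \<sigma> (i - 1) < \<sigma> i then a < b else a \<le> b)"

definition unit_cell :: "(nat \<Rightarrow> real ^ 'n::{finite,linorder}) \<Rightarrow> (real ^ 'n::{finite,linorder}) set" where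
  "unit_cell T =
     (let \<sigma> = unit_perm T; d = CARD('n) in
       {x. 0 \<le> x $ \<sigma> d \<and>
           (\<forall>i\<in>{2..d}. less_perm \<sigma> i (x $ \<sigma> i) (x $ \<sigma> (i - 1))) \<and>
           x $ \<sigma> 1 < 1})"

definition height :: "(nat \<Rightarrow> real ^ 'n) \<Rightarrow> nat \<Rightarrow> real ^ 'n::finite \<Rightarrow> real" where
  "height T i x =
     (let \<sigma> = unit_perm T; d = CARD('n) in
       if i = 0 then 1 - x $ \<sigma> 1
       else if i < d then x $ \<sigma> i - x $ \<sigma> (i + 1)
       else x $ \<sigma> d)"

definition tent_unit :: "real ^ 'n::{finite,linorder} \<Rightarrow> real" where
  "tent_unit x =
     (\<Sum>T\<in>unit_paths. \<Sum>i=0..CARD('n).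
        indicator (unit_cell T) (x + T i) * height T i (x + T i))"

definition tent :: "real \<Rightarrow> real ^ 'n::{finite,linorder} \<Rightarrow> real ^ 'n::{finite,linorder} \<Rightarrow> real" where
  "tent r \<alpha> x = tent_unit ((x - \<alpha>) /\<^sub>R r)"

definition lattice_pts :: "real \<Rightarrow> (real ^ 'n::finite) set" where
  "lattice_pts r = {\<alpha>. \<forall>i. \<exists>k::int. \<alpha> $ i = r * of_int k}"

definition scaled_path ::
  "real \<Rightarrow> (real ^ 'n) \<times> (nat \<Rightarrow> real ^ 'n) \<Rightarrow> nat \<Rightarrow> real ^ 'n::finite" where
  "scaled_path r = (\<lambda>(\<alpha>, T'). restrict (\<lambda>i. \<alpha> + r *\<^sub>R T' i) {0..CARD('n)})"

definition paths :: "real \<Rightarrow> (nat \<Rightarrow> real ^ 'n::finite) set" where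
  "paths r = scaled_path r ` (lattice_pts r \<times> unit_paths)"

text \<open>
  The pair \<open>(\<alpha>, T')\<close> with \<open>T = \<alpha> + r T'\<close>. It is unique for \<open>r > 0\<close>, see
  \<open>inj_on_scaled_path\<close> below.
\<close>

definition path_parts :: "real \<Rightarrow> (nat \<Rightarrow> real ^ 'n) \<Rightarrow> (real ^ 'n) \<times> (nat \<Rightarrow> real ^ 'n::finite)" where
  "path_parts r = the_inv_into (lattice_pts r \<times> unit_paths) (scaled_path r)"

definition path_perm :: "real \<Rightarrow> (nat \<Rightarrow> real ^ 'n) \<Rightarrow> nat \<Rightarrow> 'n::finite" where
  "path_perm r T = unit_perm (snd (path_parts r T))"

definition cell :: "real \<Rightarrow> (nat \<Rightarrow> real ^ 'n::{finite,linorder}) \<Rightarrow> (real ^ 'n::{finite,linorder}) set" where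
  "cell r T = (\<lambda>x. fst (path_parts r T) + r *\<^sub>R x) ` unit_cell (snd (path_parts r T))"

definition path_pos :: "real \<Rightarrow> (nat \<Rightarrow> real ^ 'n) \<Rightarrow> 'n::finite \<Rightarrow> nat" where
  "path_pos r T i = inv_into {1..CARD('n)} (path_perm r T) i"

definition partial :: "'n \<Rightarrow> (real ^ 'n \<Rightarrow> real) \<Rightarrow> real ^ 'n::finite \<Rightarrow> real" where
  "partial i f x = frechet_derivative f (at x) (axis i 1)"

primrec times_cont_diff :: "nat \<Rightarrow> (real ^ 'n::finite \<Rightarrow> real) \<Rightarrow> bool" where
  "times_cont_diff 0 f \<longleftrightarrow> continuous_on UNIV f"
| "times_cont_diff (Suc k) f \<longleftrightarrow>
     f differentiable_on UNIV \<and> (\<forall>i. times_cont_diff k (partial i f))"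

definition test_functions :: "(real ^ 'n::finite \<Rightarrow> real) set" where
  "test_functions = {\<phi>. (\<forall>k. times_cont_diff k \<phi>) \<and> compact (closure {x. \<phi> x \<noteq> 0})}"

definition locally_integrable :: "(real ^ 'n::finite \<Rightarrow> real) \<Rightarrow> bool" where
  "locally_integrable f \<longleftrightarrow> (\<forall>K. compact K \<longrightarrow> f absolutely_integrable_on K)"

definition has_weak_partial ::
  "'n \<Rightarrow> (real ^ 'n \<Rightarrow> real) \<Rightarrow> (real ^ 'n::finite \<Rightarrow> real) \<Rightarrow> bool" where
  "has_weak_partial i f g \<longleftrightarrow>
     locally_integrable f \<and> locally_integrable g \<and>
     (\<forall>\<phi>\<in>test_functions.
        (LINT x|lebesgue. f x * partial i \<phi> x) = - (LINT x|lebesgue. g x * \<phi> x))"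

text \<open>
  Weak derivatives are determined only up to null sets. The following operator picks an unspecified
  representative, so a property proved of it cannot depend on the choice.
\<close>

definition weak_partial :: "'n \<Rightarrow> (real ^ 'n \<Rightarrow> real) \<Rightarrow> real ^ 'n::finite \<Rightarrow> real" where
  "weak_partial i f = (SOME g. has_weak_partial i f g)"

lemma unit_path_step:
  assumes "j \<in> {1..CARD('n)}"
  shows "unit_path \<sigma> j - unit_path \<sigma> (j - 1) = (axis (\<sigma> j) 1 :: real ^ 'n::finite)"
proof -
  obtain k where "j = Suc k" using assms by (cases j) auto
  with assms show ?thesis by (simp add: unit_path_def)
qed

lemma inj_on_unit_path: "inj_on (unit_path :: (nat \<Rightarrow> 'n::finite) \<Rightarrow> _) perms"
proof (rule inj_onI)
  fix \<sigma> \<tau> :: "nat \<Rightarrow> 'n"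
  assume *: "\<sigma> \<in> perms" "\<tau> \<in> perms" "unit_path \<sigma> = unit_path \<tau>"
  show "\<sigma> = \<tau>"
  proof (rule extensionalityI[of _ "{1..CARD('n)}"])
    show "\<sigma> \<in> extensional {1..CARD('n)}" "\<tau> \<in> extensional {1..CARD('n)}"
      using * by (auto simp: perms_def)
    fix j assume "j \<in> {1..CARD('n)}"
    then have "(axis (\<sigma> j) 1 :: real ^ 'n) = axis (\<tau> j) 1"
      using unit_path_step[of j \<sigma>] unit_path_step[of j \<tau>] *(3) by metis
    then show "\<sigma> j = \<tau> j" by (simp add: axis_eq_axis)
  qed
qed

lemma unit_perm_unit_path: "\<sigma> \<in> perms \<Longrightarrow> unit_perm (unit_path \<sigma>) = \<sigma>"
  unfolding unit_perm_def by (rule the_inv_into_f_f[OF inj_on_unit_path])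

lemma unit_pathsD:
  fixes T :: "nat \<Rightarrow> real ^ 'n::finite"
  assumes "T \<in> unit_paths"
  shows "T 0 = 0" "T \<in> extensional {0..CARD('n)}"
  using assms by (auto simp: unit_paths_def unit_path_def)

lemma inj_on_scaled_path:
  assumes "r > 0"
  shows "inj_on (scaled_path r)
    (lattice_pts r \<times> (unit_paths :: (nat \<Rightarrow> real ^ 'n::finite) set))"
proof (rule inj_onI, clarify)
  fix \<alpha> \<beta> :: "real ^ 'n" and T U :: "nat \<Rightarrow> real ^ 'n"
  assume *: "T \<in> unit_paths" "U \<in> unit_paths"
    and eq: "scaled_path r (\<alpha>, T) = scaled_path r (\<beta>, U)"
  have step: "\<alpha> + r *\<^sub>R T i = \<beta> + r *\<^sub>R U i" if "i \<in> {0..CARD('n)}" for i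
    using fun_cong[OF eq, of i] that by (simp add: scaled_path_def)
  from step[of 0] * have "\<alpha> = \<beta>" by (simp add: unit_pathsD)
  moreover have "T = U"
  proof (rule extensionalityI[of _ "{0..CARD('n)}"])
    fix i assume "i \<in> {0..CARD('n)}"
    with step[of i] \<open>\<alpha> = \<beta>\<close> assms show "T i = U i" by simp
  qed (use * unit_pathsD in auto)
  ultimately show "\<alpha> = \<beta> \<and> T = U" by simp
qed

lemma path_parts_scaled_path:
  assumes "r > 0" "\<alpha> \<in> lattice_pts r" "T' \<in> unit_paths"
  shows "path_parts r (scaled_path r (\<alpha>, T')) = (\<alpha>, T')"
  unfolding path_parts_def
  using assms by (intro the_inv_into_f_f[OF inj_on_scaled_path]) auto

end

theory Submission
  imports Defs
begin

text \<open>
  Every \<open>x\<close> lies in exactly one cell: its coordinates modulo \<open>r\<close> have to be sorted by decreasing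
  value, ties being broken by decreasing index. On the cell of \<open>T\<close> the function
  \<open>\<Sum>\<^sub>\<alpha> w\<^sub>\<alpha> \<chi>\<^sub>\<alpha>\<close> is the affine interpolation of the values \<open>w\<close> at the vertices \<open>T(0), \<dots>, T(d)\<close>;
  with \<open>w = 1\<close> this is the partition of unity, and tiling the space by cubes gives the integrals.
  Since \<open>\<chi>(x) = max(0, 1 - max(0, x\<^sub>1, \<dots>, x\<^sub>d) + min(0, x\<^sub>1, \<dots>, x\<^sub>d))\<close> on the unit scale, all these
  functions are locally Lipschitz, so that the classical partial derivatives, which exist in the
  interior of the cells, are the weak ones. As the operator \<open>weak_partial\<close> is a choice, uniqueness of
  weak derivatives is needed as well; the test functions used for it are products of
  \<open>exp(-1/t)\<close> in affine functions of the coordinates, which approximate indicators of boxes.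
\<close>

subsection \<open>Smooth bump functions\<close>

text \<open>Defined as a sum over half-open pieces, the tent function does not show its continuity;
  the closed formula with two maxima supplies it, together with a Lipschitz constant. The Lipschitz
  bound carries the weak derivative: the gradient jumps across cell walls, so classical integration
  by parts does not apply directly, but bounded difference quotients that converge almost everywhere
  can be moved to the test function. The tie-break is forced by \<open>less_perm\<close>, which
  permits equal neighbouring values only where the index drops. This makes the sorting order a
  strict total order, so exactly one permutation fits and points on cell walls are counted once. The
  representatives chosen by \<open>weak_partial\<close> may deviate on a null set that depends on
  the node; the lattice is countable, so one null set serves all nodes. The integral comes from the
  partition of unity, not from volumes of simplices.\<close>

definition flat_exp :: "real poly \<Rightarrow> real \<Rightarrow> real" where
  "flat_exp p t = (if t > 0 then poly p (1 / t) * exp (- (1 / t)) else 0)"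

lemma tendsto_poly_mult_exp_0:
  "((\<lambda>s. poly p s * exp (- s)) \<longlongrightarrow> (0::real)) at_top"
proof -
  have "((\<lambda>s. \<Sum>i\<le>degree p. coeff p i * (s ^ i / exp s)) \<longlongrightarrow> (\<Sum>i\<le>degree p. coeff p i * 0)) at_top"
    by (intro tendsto_intros tendsto_power_div_exp_0)
  moreover have "(\<lambda>s. \<Sum>i\<le>degree p. coeff p i * (s ^ i / exp s)) = (\<lambda>s. poly p s * exp (- s))"
    by (simp add: poly_altdef sum_distrib_right exp_minus divide_inverse mult.assoc fun_eq_iff)
  ultimately show ?thesis by simp
qed

lemma tendsto_flat_exp_0: "(flat_exp p \<longlongrightarrow> 0) (at 0)"
proof -
  have "(flat_exp p \<longlongrightarrow> 0) (at_right 0)"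
  proof (rule Lim_transform_eventually)
    show "((\<lambda>t. poly p (1 / t) * exp (- (1 / t))) \<longlongrightarrow> 0) (at_right 0)"
      using filterlim_compose[OF tendsto_poly_mult_exp_0 filterlim_inverse_at_top_right]
      by (simp add: inverse_eq_divide)
  qed (auto simp: flat_exp_def eventually_at_filter)
  moreover have "(flat_exp p \<longlongrightarrow> 0) (at_left 0)"
    by (rule Lim_transform_eventually[OF tendsto_const])
      (auto simp: flat_exp_def eventually_at_filter)
  ultimately show ?thesis by (simp add: filterlim_at_split)
qed

text \<open>With s = 1/t, the derivative of p(s) exp(-s) in t is s^2 (p(s) - p'(s)) exp(-s).
  Carrying a polynomial in \<open>flat_exp\<close> thus makes the class closed under
  differentiation.\<close>

definition flat_exp_step :: "real poly \<Rightarrow> real poly" where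
  "flat_exp_step p = [:0, 0, 1:] * (p - pderiv p)"

lemma DERIV_flat_exp: "(flat_exp p has_real_derivative flat_exp (flat_exp_step p) t) (at t)"
proof (cases t "0::real" rule: linorder_cases)
  case less
  have "((\<lambda>t. 0) has_real_derivative flat_exp (flat_exp_step p) t) (at t)"
    using less by (simp add: flat_exp_def)
  then show ?thesis
    by (rule has_field_derivative_transform_within[where d = "- t"])
      (use less in \<open>auto simp: flat_exp_def dist_real_def\<close>)
next
  case equal
  \<comment> \<open>Dividing by h multiplies the polynomial in 1/h by its variable, so the
    difference quotient at 0 is again a \<open>flat_exp\<close> and tends to 0.\<close>
  have "((\<lambda>h. flat_exp p h / h) \<longlongrightarrow> 0) (at 0)"
    by (rule Lim_transform_eventually[OF tendsto_flat_exp_0[of "[:0, 1:] * p"]])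
      (auto simp: flat_exp_def eventually_at_filter)
  then show ?thesis by (simp add: equal DERIV_def) (simp add: flat_exp_def)
next
  case greater
  have "((\<lambda>t. poly p (1 / t) * exp (- (1 / t))) has_real_derivative flat_exp (flat_exp_step p) t) (at t)"
    using greater
    by (auto intro!: derivative_eq_intros DERIV_chain2[OF poly_DERIV]
        simp: flat_exp_def flat_exp_step_def field_simps power2_eq_square)
  then show ?thesis
    by (rule has_field_derivative_transform_within[where d = t])
      (use greater in \<open>auto simp: flat_exp_def dist_real_def\<close>)
qed

lemma has_derivative_flat_exp_coord:
  fixes x :: "real ^ 'n::finite"
  shows "((\<lambda>x. flat_exp p (c * x $ j + b)) has_derivative
     (\<lambda>h. flat_exp (flat_exp_step p) (c * x $ j + b) * (c * h $ j))) (at x)"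
proof -
  have "((\<lambda>x :: real ^ 'n. c * x $ j + b) has_derivative (\<lambda>h. c * h $ j)) (at x)"
    by (auto intro!: derivative_eq_intros bounded_linear.has_derivative[OF bounded_linear_vec_nth])
  from has_derivative_compose[OF this DERIV_flat_exp[unfolded has_field_derivative_def]]
  show ?thesis by simp
qed

section \<open>Calculus of k times continuously differentiable functions\<close>

lemma partialI: "(f has_derivative f') (at x) \<Longrightarrow> partial i f x = f' (axis i 1)"
  unfolding partial_def using frechet_derivative_at by metis

text \<open>For the product rule: its undifferentiated factors must be k times differentiable as
  well.\<close>

lemma times_cont_diff_Suc_imp: "times_cont_diff (Suc k) f \<Longrightarrow> times_cont_diff k f"
  by (induction k arbitrary: f) (auto simp: differentiable_imp_continuous_on)

lemma times_cont_diff_add: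
  "times_cont_diff k f \<Longrightarrow> times_cont_diff k g \<Longrightarrow> times_cont_diff k (\<lambda>x. f x + g x)"
proof (induction k arbitrary: f g)
  case 0
  then show ?case by (auto intro: continuous_intros)
next
  case (Suc k)
  have d: "f differentiable at x" "g differentiable at x" for x
    using Suc.prems by (auto simp: differentiable_on_def)
  have "partial i (\<lambda>x. f x + g x) = (\<lambda>x. partial i f x + partial i g x)" for i
    by (rule ext, subst partialI[OF has_derivative_add[OF d[unfolded frechet_derivative_works]]])
      (simp add: partial_def)
  with Suc d show ?case by (auto simp: differentiable_on_def)
qed

lemma times_cont_diff_mult:
  "times_cont_diff k f \<Longrightarrow> times_cont_diff k g \<Longrightarrow> times_cont_diff k (\<lambda>x. f x * g x)"
proof (induction k arbitrary: f g)
  case 0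
  then show ?case by (auto intro: continuous_intros)
next
  case (Suc k)
  have d: "f differentiable at x" "g differentiable at x" for x
    using Suc.prems by (auto simp: differentiable_on_def)
  have "partial i (\<lambda>x. f x * g x) = (\<lambda>x. f x * partial i g x + partial i f x * g x)" for i
    by (rule ext, subst partialI[OF has_derivative_mult[OF d[unfolded frechet_derivative_works]]])
      (simp add: partial_def)
  moreover have "times_cont_diff k f" "times_cont_diff k g"
    using Suc.prems times_cont_diff_Suc_imp by blast+
  ultimately show ?case using Suc d
    by (auto simp: differentiable_on_def intro!: times_cont_diff_add differentiable_mult)
qed

lemma times_cont_diff_const: "times_cont_diff k (\<lambda>x. c)"
proof (induction k arbitrary: c)
  case (Suc k)
  have "partial i (\<lambda>x. c) = (\<lambda>x. 0)" for i :: 'a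
    by (rule ext, subst partialI[OF has_derivative_const]) simp
  with Suc show ?case by (simp add: differentiable_on_def)
qed simp

lemma times_cont_diff_prod:
  assumes "\<And>j. j \<in> A \<Longrightarrow> times_cont_diff k (f j)"
  shows "times_cont_diff k (\<lambda>x. \<Prod>j\<in>A. f j x)"
  using assms by (induction A rule: infinite_finite_induct)
    (auto simp: times_cont_diff_const times_cont_diff_mult)

text \<open>The polynomial varies in the induction, since each partial derivative is a constant
  multiple of the same expression with \<open>flat_exp_step p\<close>.\<close>

lemma times_cont_diff_flat_exp:
  "times_cont_diff k (\<lambda>x :: real ^ 'n::finite. flat_exp p (c * x $ j + b))"
proof (induction k arbitrary: p)
  case 0
  show ?case
    by (simp add: continuous_at_imp_continuous_on has_derivative_continuous[OF has_derivative_flat_exp_coord])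
next
  case (Suc k)
  have "partial i (\<lambda>x :: real ^ 'n. flat_exp p (c * x $ j + b)) =
    (\<lambda>x. flat_exp (flat_exp_step p) (c * x $ j + b) * (c * axis i 1 $ j))" for i
    by (rule ext, rule partialI[OF has_derivative_flat_exp_coord])
  then show ?case
    using times_cont_diff_mult[OF Suc.IH times_cont_diff_const]
    by (auto simp: differentiable_on_def differentiable_def intro: has_derivative_flat_exp_coord)
qed

text \<open>Each factor is exp(-1/((m+1)t)) for t > 0 and 0 otherwise, so the product tends to the
  indicator of the open box as m grows. The arguments are expanded to the shape
  \<open>c * x $ j + b\<close> of the smoothness lemma.\<close>

definition box_bump :: "real ^ 'n \<Rightarrow> real ^ 'n \<Rightarrow> nat \<Rightarrow> real ^ 'n::finite \<Rightarrow> real" where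
  "box_bump a b m x = (\<Prod>j\<in>UNIV. flat_exp 1 (real (Suc m) * x $ j + - real (Suc m) * a $ j) *
     flat_exp 1 (- real (Suc m) * x $ j + real (Suc m) * b $ j))"

lemma box_bump_eq:
  "box_bump a b m x =
     (\<Prod>j\<in>UNIV. flat_exp 1 (real (Suc m) * (x $ j - a $ j)) * flat_exp 1 (real (Suc m) * (b $ j - x $ j)))"
  unfolding box_bump_def by (intro prod.cong) (auto simp: algebra_simps)

lemma flat_exp_1_bounds: "0 \<le> flat_exp 1 t" "flat_exp 1 t \<le> 1"
  by (auto simp: flat_exp_def)

lemma box_bump_bounds: "0 \<le> box_bump a b m x" "box_bump a b m x \<le> 1"
  unfolding box_bump_def
  by (intro prod_nonneg prod_le_1 ballI conjI mult_nonneg_nonneg mult_le_one flat_exp_1_bounds)+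

lemma box_bump_outside: "x \<notin> box a b \<Longrightarrow> box_bump a b m x = 0"
  unfolding box_bump_eq by (rule prod_zero) (auto simp: mem_box_cart flat_exp_def zero_less_mult_iff)

lemma box_bump_test_function: "box_bump a b m \<in> test_functions"
proof -
  have "times_cont_diff k (box_bump a b m)" for k
    unfolding box_bump_def
    by (intro times_cont_diff_prod times_cont_diff_mult times_cont_diff_flat_exp)
  moreover have "{x. box_bump a b m x \<noteq> 0} \<subseteq> box a b"
    using box_bump_outside by blast
  then have "compact (closure {x. box_bump a b m x \<noteq> 0})"
    using bounded_subset[OF bounded_box] by (simp add: compact_closure)
  ultimately show ?thesis by (simp add: test_functions_def)
qed

lemma tendsto_flat_exp_1:
  assumes "t > 0"
  shows "(\<lambda>m. flat_exp 1 (real (Suc m) * t)) \<longlonglongrightarrow> 1"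
proof -
  have "(\<lambda>m. exp (- (1 / t * (1 / real (Suc m))))) \<longlonglongrightarrow> exp (- (1 / t * 0))"
    by (intro tendsto_intros LIMSEQ_Suc[OF lim_1_over_n])
  moreover have "(\<lambda>m. exp (- (1 / t * (1 / real (Suc m))))) = (\<lambda>m. flat_exp 1 (real (Suc m) * t))"
    using assms by (auto simp: flat_exp_def zero_less_mult_iff fun_eq_iff)
  ultimately show ?thesis by simp
qed

lemma tendsto_box_bump:
  fixes x :: "real ^ 'n::finite"
  shows "(\<lambda>m. box_bump a b m x) \<longlonglongrightarrow> indicator (box a b) x"
proof (cases "x \<in> box a b")
  case True
  have "(\<lambda>m. box_bump a b m x) \<longlonglongrightarrow> (\<Prod>j\<in>(UNIV :: 'n set). 1 * 1)"
    unfolding box_bump_eq using True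
    by (intro tendsto_prod tendsto_mult[OF tendsto_flat_exp_1 tendsto_flat_exp_1]) (auto simp: mem_box_cart)
  with True show ?thesis by simp
qed (simp add: box_bump_outside)

subsection \<open>Uniqueness of weak partial derivatives\<close>

text \<open>Dynkin's argument: open boxes are closed under intersection and generate the Borel sets,
  and the sets over which \<open>h\<close> integrates to 0 form a Dynkin system. A density whose
  integrals all vanish is 0 almost everywhere.\<close>

lemma AE_zero_if_set_integral_boxes_zero:
  fixes h :: "'a::euclidean_space \<Rightarrow> real"
  assumes h: "integrable lborel h"
    and box: "\<And>a b. (LINT x|lborel. indicator (box a b) x * h x) = 0"
  shows "AE x in lborel. h x = 0"
proof -
  have int: "integrable lborel (\<lambda>x. indicator A x * h x)" if "A \<in> sets borel" for A
    using integrable_mult_indicator[OF _ h, of A] that by simp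
  \<comment> \<open>Complements in the induction need the integral over the whole space, obtained as
    a limit over growing cubes.\<close>
  have all: "(LINT x|lborel. h x) = 0"
  proof -
    have "(\<lambda>k. LINT x|lborel. indicator (box (- real k *\<^sub>R One) (real k *\<^sub>R One)) x * h x) \<longlonglongrightarrow> (LINT x|lborel. h x)"
    proof (rule integral_dominated_convergence[where w = "\<lambda>x. norm (h x)"])
      show "AE x in lborel. (\<lambda>k. indicator (box (- real k *\<^sub>R One) (real k *\<^sub>R One)) x * h x) \<longlonglongrightarrow> h x"
      proof (rule AE_I2)
        fix x :: 'a
        obtain K :: nat where K: "norm x < real K" using reals_Archimedean2 by blast
        have "x \<in> box (- real k *\<^sub>R One) (real k *\<^sub>R One)" if "k \<ge> K" for k
        proof -
          have "\<bar>x \<bullet> i\<bar> < real k" if "i \<in> Basis" for i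
            using Basis_le_norm[OF that, of x] K \<open>k \<ge> K\<close> by linarith
          then show ?thesis by (simp add: mem_box abs_less_iff minus_less_iff)
        qed
        then have "\<forall>\<^sub>F k in sequentially. indicator (box (- real k *\<^sub>R One) (real k *\<^sub>R One)) x * h x = h x"
          unfolding eventually_sequentially by (intro exI[of _ K]) (simp del: scaleR_minus_left)
        then show "(\<lambda>k. indicator (box (- real k *\<^sub>R One) (real k *\<^sub>R One)) x * h x) \<longlonglongrightarrow> h x"
          by (rule tendsto_eventually)
      qed
    qed (use h in \<open>auto simp: indicator_def\<close>)
    then show ?thesis by (simp add: box LIMSEQ_const_iff)
  qed
  have "(LINT x|lborel. indicator A x * h x) = 0" if "A \<in> sets borel" for A
  proof -
    have "Int_stable (range (\<lambda>(a, b). box a b :: 'a set))"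
      by (auto simp: Int_stable_def box_Int_box)
    moreover have "range (\<lambda>(a, b). box a b :: 'a set) \<subseteq> Pow UNIV" by simp
    moreover have "A \<in> sigma_sets UNIV (range (\<lambda>(a, b). box a b :: 'a set))"
      using that by (simp add: borel_eq_box)
    ultimately show ?thesis
    proof (induction rule: sigma_sets_induct_disjoint)
      case (compl A)
      then have [measurable]: "A \<in> sets borel" by (simp add: borel_eq_box)
      have "(LINT x|lborel. indicator (UNIV - A) x * h x) =
          (LINT x|lborel. h x - indicator A x * h x)"
        by (intro Bochner_Integration.integral_cong) (auto simp: indicator_def)
      also have "\<dots> = 0" using h int[of A] compl all by simp
      finally show ?case .
    next
      case (union A)
      then have A: "A i \<in> sets borel" for i by (auto simp: borel_eq_box)
      have "(LINT x:(\<Union>i. A i)|lborel. h x) = (\<Sum>i. (LINT x:A i|lborel. h x))"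
        using union(1) A int[OF sets.countable_nat_UN, of A]
        by (intro lebesgue_integral_countable_add) (auto simp: disjoint_family_on_def set_integrable_def)
      then show ?case using union by (simp add: set_lebesgue_integral_def)
    qed (auto simp: box)
  qed
  then show ?thesis
    using density_unique_real[OF h integrable_zero] by (simp add: set_lebesgue_integral_def)
qed

text \<open>Bumps converging to the indicator of a box turn the identity for test functions into
  vanishing box integrals of the difference. The difference is only locally integrable, so it is cut
  off to a box before the vanishing criterion is applied, and countably many cubes then cover the
  space.\<close>

lemma has_weak_partial_unique:
  fixes f :: "real ^ 'n::finite \<Rightarrow> real"
  assumes g1: "has_weak_partial i f g1" and g2: "has_weak_partial i f g2"
  shows "AE x in lebesgue. g1 x = g2 x"
proof -
  define h where "h = (\<lambda>x. g1 x - g2 x)"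
  \<comment> \<open>Local integrability speaks of compact sets, hence the closed box here although
    the bumps live on the open one.\<close>
  have loc: "integrable lebesgue (\<lambda>x. indicator (cbox a b) x * g x)"
    if "locally_integrable g" for g and a b :: "real ^ 'n"
    using that by (auto simp: locally_integrable_def set_integrable_def)
  have li: "locally_integrable g1" "locally_integrable g2"
    using g1 g2 by (auto simp: has_weak_partial_def)
  have box0: "(LINT x|lebesgue. indicator (box a b) x * h x) = 0" for a b
  proof -
    have bump: "integrable lebesgue (\<lambda>x. g x * box_bump a b m x)" if "locally_integrable g" for g m
    proof -
      have "continuous_on UNIV (box_bump a b m)"
        using box_bump_test_function[of a b m] times_cont_diff.simps(1) unfolding test_functions_def by blast
      then have "box_bump a b m \<in> borel_measurable lborel"
        by (simp add: borel_measurable_continuous_onI)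
      then have m: "box_bump a b m \<in> borel_measurable lebesgue"
        by (rule measurable_completion)
      have "integrable lebesgue (\<lambda>x. (indicator (cbox a b) x * g x) * box_bump a b m x)"
      proof (rule Bochner_Integration.integrable_bound[OF loc[OF that]])
        show "(\<lambda>x. indicat_real (cbox a b) x * g x * box_bump a b m x) \<in> borel_measurable lebesgue"
          using borel_measurable_integrable[OF loc[OF that]] m by (rule borel_measurable_times)
        show "AE x in lebesgue. norm (indicator (cbox a b) x * g x * box_bump a b m x)
            \<le> norm (indicator (cbox a b) x * g x)"
          using box_bump_bounds[of a b m] by (auto simp: abs_mult intro!: mult_left_le AE_I2)
      qed
      moreover have "(\<lambda>x. (indicator (cbox a b) x * g x) * box_bump a b m x) = (\<lambda>x. g x * box_bump a b m x)"
        using box_bump_outside[of _ a b m] box_subset_cbox[of a b]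
        by (auto simp: indicator_def fun_eq_iff subset_iff)
      ultimately show ?thesis by simp
    qed
    have zero: "(LINT x|lebesgue. h x * box_bump a b m x) = 0" for m
    proof -
      have "(LINT x|lebesgue. h x * box_bump a b m x) =
          (LINT x|lebesgue. g1 x * box_bump a b m x) - (LINT x|lebesgue. g2 x * box_bump a b m x)"
        unfolding h_def left_diff_distrib
        by (intro Bochner_Integration.integral_diff bump li)
      also have "\<dots> = 0"
        using g1 g2 box_bump_test_function[of a b m] unfolding has_weak_partial_def by fastforce
      finally show ?thesis .
    qed
    have hb: "integrable lebesgue (\<lambda>x. indicator (cbox a b) x * h x)"
      unfolding h_def right_diff_distrib by (intro Bochner_Integration.integrable_diff loc li)
    have "(\<lambda>m. LINT x|lebesgue. h x * box_bump a b m x) \<longlonglongrightarrow> (LINT x|lebesgue. indicator (box a b) x * h x)"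
    proof (rule integral_dominated_convergence[where w = "\<lambda>x. norm (indicator (cbox a b) x * h x)"])
      \<comment> \<open>Integrability, and with it measurability, of \<open>h\<close> is at hand
        only after the cut-off to the closed box; on the open box that extra factor changes
        nothing.\<close>
      have "(\<lambda>x. indicator (box a b) x * (indicator (cbox a b) x * h x)) \<in> borel_measurable lebesgue"
        by (intro borel_measurable_times[OF borel_measurable_indicator borel_measurable_integrable[OF hb]]) simp
      then show "(\<lambda>x. indicator (box a b) x * h x) \<in> borel_measurable lebesgue"
        by (rule measurable_cong[THEN iffD1, rotated])
          (use box_subset_cbox[of a b] in \<open>auto simp: indicator_def\<close>)
      show "(\<lambda>x. h x * box_bump a b m x) \<in> borel_measurable lebesgue" for m
        unfolding h_def left_diff_distrib
        by (intro borel_measurable_diff borel_measurable_integrable bump li)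
      show "AE x in lebesgue. (\<lambda>m. h x * box_bump a b m x) \<longlonglongrightarrow> indicator (box a b) x * h x"
        by (intro AE_I2, subst mult.commute[of "indicator _ _"], intro tendsto_mult_left tendsto_box_bump)
      show "AE x in lebesgue. norm (h x * box_bump a b m x) \<le> norm (indicator (cbox a b) x * h x)" for m
      proof (rule AE_I2)
        fix x
        show "norm (h x * box_bump a b m x) \<le> norm (indicator (cbox a b) x * h x)"
        proof (cases "x \<in> box a b")
          case True
          then show ?thesis
            using box_bump_bounds[of a b m x] box_subset_cbox[of a b]
            by (auto simp: abs_mult indicator_def intro!: mult_left_le)
        qed (simp add: box_bump_outside)
      qed
    qed (use hb in auto)
    then show ?thesis by (simp add: zero LIMSEQ_const_iff)
  qed
  have AE_k: "AE x in lebesgue. indicator (box a b) x * h x = 0" for a b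
  proof -
    define k where "k = (\<lambda>x. indicator (box a b) x * (indicator (cbox a b) x * h x))"
    have "integrable lebesgue (\<lambda>x. indicator (cbox a b) x * h x)"
      unfolding h_def right_diff_distrib by (intro Bochner_Integration.integrable_diff loc li)
    then have k: "integrable lebesgue k"
      unfolding k_def using integrable_mult_indicator[of "box a b" lebesgue "\<lambda>x. indicator (cbox a b) x * h x"] by simp
    have k_eq: "k x = indicator (box a b) x * h x" for x
      using box_subset_cbox[of a b] by (auto simp: k_def indicator_def)
    \<comment> \<open>The vanishing criterion lives on \<open>lborel\<close>, so \<open>k\<close> is
      exchanged for a Borel function that agrees with it almost everywhere.\<close>
    from completion_ex_borel_measurable_real[OF borel_measurable_integrable[OF k]]
    obtain k' where k': "k' \<in> borel_measurable lborel" and eq: "AE x in lborel. k x = k' x" by blast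
    have k'_leb: "k' \<in> borel_measurable lebesgue" using k' by (rule measurable_completion)
    have eq': "AE x in lebesgue. k x = k' x" using eq by (rule AE_completion)
    have "integrable lebesgue k'"
      using integrable_cong_AE_imp[OF k k'_leb] eq' by (simp add: eq_commute)
    then have "integrable lborel k'" using k' by (simp add: integrable_completion)
    moreover have "(LINT x|lborel. indicator (box c e) x * k' x) = 0" for c e
    proof -
      \<comment> \<open>Boxes intersect in boxes, so the cut-off keeps the integrals within those
        already known to vanish.\<close>
      obtain u v where uv: "box c e \<inter> box a b = box u v" using box_Int_box[of c e a b] by blast
      have "(LINT x|lborel. indicator (box c e) x * k' x) = (LINT x|lebesgue. indicator (box c e) x * k' x)"
        using k' by (intro integral_completion[symmetric]) simp
      also have "\<dots> = (LINT x|lebesgue. indicator (box c e) x * k x)"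
        by (intro integral_cong_AE borel_measurable_times[OF borel_measurable_indicator] k'_leb
            borel_measurable_integrable[OF k] eventually_mono[OF eq']) auto
      also have "\<dots> = (LINT x|lebesgue. indicator (box u v) x * h x)"
        by (intro Bochner_Integration.integral_cong) (auto simp: k_eq uv[symmetric] indicator_def)
      finally show ?thesis using box0 by simp
    qed
    ultimately have "AE x in lborel. k' x = 0" by (rule AE_zero_if_set_integral_boxes_zero)
    then have "AE x in lebesgue. k' x = 0" by (rule AE_completion)
    with eq' show ?thesis by eventually_elim (simp add: k_eq)
  qed
  have "AE x in lebesgue. \<forall>m::nat. indicator (box (\<chi> j. - real m) (\<chi> j. real m)) x * h x = 0"
    unfolding AE_all_countable using AE_k by blast
  then show ?thesis
  proof eventually_elim
    case (elim x)
    obtain m :: nat where m: "norm x < real m" using reals_Archimedean2 by blast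
    have "\<bar>x $ j\<bar> < real m" for j using component_le_norm_cart[of x j] m by linarith
    then have "x \<in> box (\<chi> j. - real m) (\<chi> j. real m)"
      by (auto simp: mem_box_cart abs_less_iff minus_less_iff)
    with elim[rule_format, of m] show ?case by (simp add: h_def)
  qed
qed

subsection \<open>Difference quotients and weak partial derivatives\<close>

lemma integrable_lborel_continuous_cball:
  fixes h :: "'a::euclidean_space \<Rightarrow> real"
  assumes "continuous_on UNIV h" and out: "\<And>x. norm x > R \<Longrightarrow> h x = 0"
  shows "integrable lborel h"
proof -
  have "integrable lborel (\<lambda>x. indicator (cball 0 R) x *\<^sub>R h x)"
    using assms by (intro borel_integrable_compact) (auto intro: continuous_on_subset)
  moreover have "(\<lambda>x. indicator (cball 0 R) x *\<^sub>R h x) = h"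
    using out by (force simp: indicator_def fun_eq_iff not_le)
  ultimately show ?thesis by simp
qed

lemma integral_lborel_translation:
  fixes h :: "'a::euclidean_space \<Rightarrow> real"
  assumes "h \<in> borel_measurable borel"
  shows "(LINT x|lborel. h (x + c)) = (LINT x|lborel. h x)"
proof -
  have "(LINT x|lborel. h x) = (LINT x|distr lborel borel ((+) c). h x)"
    by (simp add: lborel_distr_plus)
  also have "\<dots> = (LINT x|lborel. h (c + x))"
    using assms by (intro integral_distr) auto
  finally show ?thesis by (simp add: add.commute)
qed

text \<open>The global Lipschitz constant in direction \<open>i\<close> is a bound for the
  continuous function \<open>partial i \<phi>\<close> on a ball, turned into a bound for differences
  by the mean value inequality along the line.\<close>

lemma test_function_diff_quotient:
  fixes \<phi> :: "real ^ 'n::finite \<Rightarrow> real"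
  assumes "\<phi> \<in> test_functions"
  shows "continuous_on UNIV \<phi>" "continuous_on UNIV (partial i \<phi>)"
    and "\<exists>R L. R \<ge> 0 \<and> L \<ge> 0 \<and> (\<forall>x. norm x > R \<longrightarrow> \<phi> x = 0) \<and>
      (\<forall>x t. \<bar>\<phi> (x + t *\<^sub>R axis i 1) - \<phi> x\<bar> \<le> L * \<bar>t\<bar>)"
    and "((\<lambda>t. (\<phi> (x + t *\<^sub>R axis i 1) - \<phi> x) / t) \<longlongrightarrow> partial i \<phi> x) (at 0)"
proof -
  have t: "times_cont_diff k \<phi>" for k using assms by (simp add: test_functions_def)
  show c: "continuous_on UNIV \<phi>" using t[of 0] by simp
  show cp: "continuous_on UNIV (partial i \<phi>)" using t[of "Suc 0"] by simp
  have d: "\<phi> differentiable at x" for x using t[of 1] by (simp add: differentiable_on_def)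
  have deriv: "((\<lambda>t. \<phi> (x + t *\<^sub>R axis i 1)) has_real_derivative partial i \<phi> (x + t *\<^sub>R axis i 1)) (at t)"
    for x t
  proof -
    let ?D = "frechet_derivative \<phi> (at (x + t *\<^sub>R axis i 1))"
    have D: "(\<phi> has_derivative ?D) (at (x + t *\<^sub>R axis i 1))"
      using d by (simp add: frechet_derivative_works)
    have "((\<lambda>t. x + t *\<^sub>R axis i 1) has_derivative (\<lambda>h. h *\<^sub>R axis i 1)) (at t)"
      by (auto intro!: derivative_eq_intros)
    from has_derivative_compose[OF this D]
    have "((\<lambda>t. \<phi> (x + t *\<^sub>R axis i 1)) has_derivative (\<lambda>h. ?D (h *\<^sub>R axis i 1))) (at t)" .
    moreover have "(\<lambda>h. ?D (h *\<^sub>R axis i 1)) = (*) (partial i \<phi> (x + t *\<^sub>R axis i 1))"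
      using linear_scale[OF has_derivative_linear[OF D]] by (auto simp: partial_def)
    ultimately show ?thesis by (simp add: has_field_derivative_def)
  qed
  show "((\<lambda>t. (\<phi> (x + t *\<^sub>R axis i 1) - \<phi> x) / t) \<longlongrightarrow> partial i \<phi> x) (at 0)"
    using deriv[of x 0] by (simp add: DERIV_def)
  have "bounded (closure {x. \<phi> x \<noteq> 0})"
    using assms by (auto simp: test_functions_def intro: compact_imp_bounded)
  then have "bounded {x. \<phi> x \<noteq> 0}" using bounded_subset closure_subset by blast
  then obtain R where R: "R > 0" "\<And>x. \<phi> x \<noteq> 0 \<Longrightarrow> norm x \<le> R"
    unfolding bounded_pos by auto
  then have R0: "\<phi> x = 0" if "norm x > R" for x using that leD by blast
  have p0: "partial i \<phi> x = 0" if "norm x > R" for x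
  proof -
    \<comment> \<open>Off the closed ball \<phi> vanishes on an open set, so its partial derivative
      is 0 there and a bound on the ball is global.\<close>
    have "open {x :: real ^ 'n. norm x > R}" by (intro open_Collect_less continuous_intros)
    then have "(\<phi> has_derivative (\<lambda>h. 0)) (at x)"
      using has_derivative_transform_within_open[of "\<lambda>x. 0" "\<lambda>h. 0" x UNIV "{x. norm x > R}" \<phi>] that R0
      by simp
    then show ?thesis by (rule partialI)
  qed
  have "compact (partial i \<phi> ` cball 0 R)"
    by (intro compact_continuous_image continuous_on_subset[OF cp]) auto
  then obtain L where L: "L > 0" "\<And>x. x \<in> cball 0 R \<Longrightarrow> \<bar>partial i \<phi> x\<bar> \<le> L"
    using compact_imp_bounded bounded_pos by (metis imageI real_norm_def)
  have pL: "\<bar>partial i \<phi> x\<bar> \<le> L" for x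
    using L(2)[of x] p0[of x] L(1) by (cases "norm x > R") auto
  have "\<bar>\<phi> (x + t *\<^sub>R axis i 1) - \<phi> x\<bar> \<le> L * \<bar>t\<bar>" for x t
    using field_differentiable_bound[of UNIV "\<lambda>t. \<phi> (x + t *\<^sub>R axis i 1)"
        "\<lambda>t. partial i \<phi> (x + t *\<^sub>R axis i 1)" L t 0] deriv[of x] pL
    by (simp add: has_field_derivative_at_within)
  then show "\<exists>R L. R \<ge> 0 \<and> L \<ge> 0 \<and> (\<forall>x. norm x > R \<longrightarrow> \<phi> x = 0) \<and>
      (\<forall>x t. \<bar>\<phi> (x + t *\<^sub>R axis i 1) - \<phi> x\<bar> \<le> L * \<bar>t\<bar>)"
    using R R0 L by (intro exI[of _ R] exI[of _ L]) auto
qed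

text \<open>Translation invariance of the Lebesgue measure moves the difference quotient from \<open>f\<close>
  to the test function; both sides then converge by dominated convergence.\<close>

lemma has_weak_partialI:
  fixes f g :: "real ^ 'n::finite \<Rightarrow> real"
  assumes lip: "\<And>R. \<exists>C. C-lipschitz_on (cball 0 R) f"
    and der: "AE x in lebesgue. ((\<lambda>t. (f (x + t *\<^sub>R axis i 1) - f x) / t) \<longlongrightarrow> g x) (at 0)"
  shows "has_weak_partial i f g"
proof -
  obtain C where C: "\<And>R. (C R)-lipschitz_on (cball 0 R) f" using lip by metis
  define e :: "real ^ 'n" where "e = axis i 1"
  have e: "norm e = 1" by (simp add: e_def norm_axis_1)
  \<comment> \<open>Steps of size at most 1 keep points of the ball of radius \<open>R\<close> in
    the ball of radius \<open>R + 1\<close>; this explains the radii \<open>R + 1\<close>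
    below.\<close>
  define s where "s n = 1 / real (Suc n)" for n
  have s: "0 < s n" "s n \<le> 1" for n by (auto simp: s_def)
  have s0: "s \<longlonglongrightarrow> 0" unfolding s_def by (rule LIMSEQ_Suc[OF lim_1_over_n])
  define q where "q n x = (f (x + s n *\<^sub>R e) - f x) / s n" for n x
  have cf: "continuous_on UNIV f"
  proof (rule continuous_at_imp_continuous_on, rule ballI)
    fix x
    show "isCont f x"
      by (rule continuous_on_interior[OF lipschitz_on_continuous_on[OF C[of "norm x + 1"]]]) simp
  qed
  have q_bound: "\<bar>q n x\<bar> \<le> C (R + 1)" if "norm x \<le> R" for n x R
  proof -
    have "norm (x + s n *\<^sub>R e) \<le> R + 1"
      using norm_triangle_ineq[of x "s n *\<^sub>R e"] that e s[of n] by simp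
    then have "dist (f (x + s n *\<^sub>R e)) (f x) \<le> C (R + 1) * dist (x + s n *\<^sub>R e) x"
      using that by (intro lipschitz_onD[OF C]) auto
    then show ?thesis
      using s[of n] e by (simp add: q_def dist_norm divide_le_eq abs_divide)
  qed
  have q_cont: "continuous_on UNIV (q n)" for n
    unfolding q_def using s[of n]
    by (intro continuous_intros continuous_on_compose2[OF cf]) auto
  have q_meas: "q n \<in> borel_measurable borel" for n
    using q_cont by (rule borel_measurable_continuous_onI)
  have q_lim: "AE x in lebesgue. (\<lambda>n. q n x) \<longlonglongrightarrow> g x"
    using der
  proof eventually_elim
    case (elim x)
    have "filterlim s (at 0) sequentially"
      using s0 s(1) by (intro filterlim_atI) (auto simp: less_imp_neq[symmetric])
    from filterlim_compose[OF elim this] show ?case by (simp add: q_def e_def)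
  qed
  \<comment> \<open>\<open>g\<close> is arbitrary on a null set, so its measurability rests on the
    completeness of Lebesgue measure.\<close>
  have g_meas: "g \<in> borel_measurable lebesgue"
  proof (rule borel_measurable_AE)
    show "(\<lambda>x. lim (\<lambda>n. q n x)) \<in> borel_measurable lebesgue"
      using q_meas by (intro measurable_completion) measurable
    show "AE x in lebesgue. lim (\<lambda>n. q n x) = g x"
      using q_lim by eventually_elim (rule limI)
  qed
  have g_bound: "AE x in lebesgue. norm x \<le> R \<longrightarrow> \<bar>g x\<bar> \<le> C (R + 1)" for R
    using q_lim
  proof eventually_elim
    case (elim x)
    show ?case
      using q_bound[of x R] by (auto intro!: LIMSEQ_le_const2[OF tendsto_rabs[OF elim]])
  qed
  have lf: "locally_integrable f"
    unfolding locally_integrable_def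
  proof (intro allI impI)
    fix K :: "(real ^ 'n) set" assume K: "compact K"
    have "integrable lborel (\<lambda>x. indicator K x *\<^sub>R f x)"
      by (intro borel_integrable_compact[OF K] continuous_on_subset[OF cf]) auto
    then show "f absolutely_integrable_on K"
      using integrable_completion[OF borel_measurable_integrable] by (auto simp: set_integrable_def)
  qed
  have lg: "locally_integrable g"
    unfolding locally_integrable_def set_integrable_def
  proof (intro allI impI)
    fix K :: "(real ^ 'n) set" assume K: "compact K"
    then obtain R where R: "\<And>x. x \<in> K \<Longrightarrow> norm x \<le> R"
      using compact_imp_bounded bounded_iff by metis
    have Kl: "K \<in> lmeasurable" using K by (rule lmeasurable_compact)
    show "integrable lebesgue (\<lambda>x. indicator K x *\<^sub>R g x)"
    proof (rule Bochner_Integration.integrable_bound)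
      show "integrable lebesgue (\<lambda>x. indicator K x * C (R + 1))"
        using Kl by (intro integrable_mult_left) (auto simp: fmeasurable_def)
      show "(\<lambda>x. indicator K x *\<^sub>R g x) \<in> borel_measurable lebesgue"
        using g_meas Kl by (intro borel_measurable_scaleR borel_measurable_indicator) (auto simp: fmeasurable_def)
      show "AE x in lebesgue. norm (indicator K x *\<^sub>R g x) \<le> norm (indicator K x * C (R + 1))"
        using g_bound[of R] by eventually_elim (use R in \<open>auto simp: indicator_def\<close>)
    qed
  qed
  have "(LINT x|lebesgue. f x * partial i \<phi> x) = - (LINT x|lebesgue. g x * \<phi> x)"
    if \<phi>: "\<phi> \<in> test_functions" for \<phi>
  proof -
    note c\<phi> = test_function_diff_quotient(1)[OF \<phi>]
    obtain R L where R: "R \<ge> 0" "\<And>x. norm x > R \<Longrightarrow> \<phi> x = 0"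
      and L: "L \<ge> 0" "\<And>x t. \<bar>\<phi> (x + t *\<^sub>R e) - \<phi> x\<bar> \<le> L * \<bar>t\<bar>"
      using test_function_diff_quotient(3)[OF \<phi>, of i] unfolding e_def by blast
    \<comment> \<open>The backward quotient: a forward shift of \<open>f\<close> becomes a backward
      shift of \<phi> under the translation, and the minus sign of integration by parts arises with
      it.\<close>
    define p where "p n x = (\<phi> x - \<phi> (x - s n *\<^sub>R e)) / s n" for n x
    have p_cont: "continuous_on UNIV (p n)" for n
      unfolding p_def using s[of n]
      by (intro continuous_intros continuous_on_compose2[OF c\<phi>]) auto
    have p_bound: "\<bar>p n x\<bar> \<le> L" for n x
      using L(2)[of x "- s n"] s[of n] by (simp add: p_def divide_le_eq abs_divide abs_minus_commute)
    have p_out: "p n x = 0" if "norm x > R + 1" for n x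
    proof -
      have "norm (x - s n *\<^sub>R e) > R"
        using norm_triangle_ineq2[of x "s n *\<^sub>R e"] that e s[of n] by simp
      then show ?thesis using R that by (simp add: p_def)
    qed
    have p_lim: "(\<lambda>n. p n x) \<longlonglongrightarrow> partial i \<phi> x" for x
    proof -
      have "filterlim (\<lambda>n. - s n) (at 0) sequentially"
        using tendsto_minus[OF s0] s(1) by (intro filterlim_atI) (auto simp: less_imp_neq[symmetric])
      from filterlim_compose[OF test_function_diff_quotient(4)[OF \<phi>] this]
      have "(\<lambda>n. (\<phi> (x + - s n *\<^sub>R e) - \<phi> x) / - s n) \<longlonglongrightarrow> partial i \<phi> x" by (simp add: e_def)
      moreover have "(\<phi> (x + - s n *\<^sub>R e) - \<phi> x) / - s n = p n x" for n
        by (simp add: p_def minus_divide_left)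
      ultimately show ?thesis by simp
    qed
    have meas: "h \<in> borel_measurable lebesgue" if "continuous_on UNIV h" for h :: "real ^ 'n \<Rightarrow> real"
      using that by (intro measurable_completion) (simp add: borel_measurable_continuous_onI)
    have leb: "integrable lebesgue h" "(LINT x|lebesgue. h x) = (LINT x|lborel. h x)"
      if "continuous_on UNIV h" "\<And>x. norm x > R + 1 \<Longrightarrow> h x = 0" for h :: "real ^ 'n \<Rightarrow> real"
      using integrable_lborel_continuous_cball[OF that] that(1)
      by (auto simp: integral_completion integrable_completion borel_measurable_continuous_onI)
    have shift: "(LINT x|lebesgue. q n x * \<phi> x) = - (LINT x|lebesgue. f x * p n x)" for n
    proof -
      \<comment> \<open>The common term of both sides: \<open>q n x * \<phi> x\<close> contains
        \<open>u\<close> translated by \<open>s n *\<^sub>R e\<close>, whereas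
        \<open>f x * p n x\<close> contains \<open>u\<close> itself.\<close>
      define u where "u x = f x * \<phi> (x - s n *\<^sub>R e)" for x
      have cu: "continuous_on UNIV u"
        unfolding u_def by (intro continuous_intros cf continuous_on_compose2[OF c\<phi>]) auto
      have cu': "continuous_on UNIV (\<lambda>x. u (x + s n *\<^sub>R e))"
        by (intro continuous_intros continuous_on_compose2[OF cu]) auto
      have cfp: "continuous_on UNIV (\<lambda>x. f x * \<phi> x)" by (intro continuous_intros cf c\<phi>)
      have u_out: "u x = 0" if "norm x > R + 1" for x
      proof -
        have "norm (x - s n *\<^sub>R e) > R"
          using norm_triangle_ineq2[of x "s n *\<^sub>R e"] that e s[of n] by simp
        then show ?thesis using R by (simp add: u_def)
      qed
      have u_out': "u (x + s n *\<^sub>R e) = 0" if "norm x > R + 1" for x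
        using R that by (simp add: u_def)
      have iu: "integrable lborel u" using cu u_out by (rule integrable_lborel_continuous_cball)
      have iu': "integrable lborel (\<lambda>x. u (x + s n *\<^sub>R e))"
        using cu' u_out' by (rule integrable_lborel_continuous_cball)
      have ifp: "integrable lborel (\<lambda>x. f x * \<phi> x)"
        using cfp by (rule integrable_lborel_continuous_cball[where R = R]) (simp add: R)
      have "(LINT x|lebesgue. q n x * \<phi> x) = (LINT x|lborel. q n x * \<phi> x)"
        using R by (intro leb continuous_intros q_cont c\<phi>) auto
      also have "\<dots> = (LINT x|lborel. (u (x + s n *\<^sub>R e) - f x * \<phi> x) / s n)"
        by (simp add: q_def u_def left_diff_distrib)
      also have "\<dots> = ((LINT x|lborel. u (x + s n *\<^sub>R e)) - (LINT x|lborel. f x * \<phi> x)) / s n"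
        using iu' ifp by simp
      also have "(LINT x|lborel. u (x + s n *\<^sub>R e)) = (LINT x|lborel. u x)"
        using cu by (intro integral_lborel_translation borel_measurable_continuous_onI)
      also have "((LINT x|lborel. u x) - (LINT x|lborel. f x * \<phi> x)) / s n
          = - (LINT x|lborel. (f x * \<phi> x - u x) / s n)"
        using iu ifp by (simp add: minus_divide_left)
      also have "(LINT x|lborel. (f x * \<phi> x - u x) / s n) = (LINT x|lborel. f x * p n x)"
        by (simp add: p_def u_def right_diff_distrib)
      also have "\<dots> = (LINT x|lebesgue. f x * p n x)"
        using p_out by (intro leb(2)[symmetric] continuous_intros p_cont cf) auto
      finally show ?thesis .
    qed
    have "(\<lambda>n. LINT x|lebesgue. q n x * \<phi> x) \<longlonglongrightarrow> (LINT x|lebesgue. g x * \<phi> x)"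
    \<comment> \<open>Off the ball of radius \<open>R\<close> the test function kills the product;
      on it the quotients of \<open>f\<close> obey the Lipschitz bound for radius
      \<open>R + 1\<close>.\<close>
    proof (rule integral_dominated_convergence[where w = "\<lambda>x. C (R + 1) * \<bar>\<phi> x\<bar>"])
      show "(\<lambda>x. g x * \<phi> x) \<in> borel_measurable lebesgue"
        by (intro borel_measurable_times g_meas meas c\<phi>)
      show "(\<lambda>x. q n x * \<phi> x) \<in> borel_measurable lebesgue" for n
        by (intro borel_measurable_times meas c\<phi> q_cont)
      show "integrable lebesgue (\<lambda>x. C (R + 1) * \<bar>\<phi> x\<bar>)"
        using R by (intro leb continuous_intros c\<phi>) auto
      show "AE x in lebesgue. (\<lambda>n. q n x * \<phi> x) \<longlonglongrightarrow> g x * \<phi> x"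
        using q_lim by eventually_elim (intro tendsto_intros)
      show "AE x in lebesgue. norm (q n x * \<phi> x) \<le> C (R + 1) * \<bar>\<phi> x\<bar>" for n
      proof (rule AE_I2)
        fix x
        show "norm (q n x * \<phi> x) \<le> C (R + 1) * \<bar>\<phi> x\<bar>"
          using q_bound[of x R n] R(2)[of x]
          by (cases "norm x > R") (auto simp: abs_mult intro: mult_right_mono)
      qed
    qed
    moreover have "(\<lambda>n. LINT x|lebesgue. f x * p n x) \<longlonglongrightarrow> (LINT x|lebesgue. f x * partial i \<phi> x)"
    \<comment> \<open>All \<open>p n\<close> vanish off one ball of radius \<open>R + 1\<close> and
      are bounded by \<open>L\<close>, uniformly in \<open>n\<close>.\<close>
    proof (rule integral_dominated_convergence[where w = "\<lambda>x. indicator (cball 0 (R + 1)) x *\<^sub>R (\<bar>f x\<bar> * L)"])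
      show "(\<lambda>x. f x * partial i \<phi> x) \<in> borel_measurable lebesgue"
        by (intro borel_measurable_times meas cf test_function_diff_quotient(2)[OF \<phi>])
      show "(\<lambda>x. f x * p n x) \<in> borel_measurable lebesgue" for n
        by (intro borel_measurable_times meas cf p_cont)
      have "integrable lborel (\<lambda>x. indicator (cball 0 (R + 1)) x *\<^sub>R (\<bar>f x\<bar> * L))"
        by (intro borel_integrable_compact continuous_intros continuous_on_subset[OF cf]) auto
      then show "integrable lebesgue (\<lambda>x. indicator (cball 0 (R + 1)) x *\<^sub>R (\<bar>f x\<bar> * L))"
        using integrable_completion[OF borel_measurable_integrable] by blast
      show "AE x in lebesgue. (\<lambda>n. f x * p n x) \<longlonglongrightarrow> f x * partial i \<phi> x"
        using p_lim by (intro AE_I2 tendsto_intros)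
      show "AE x in lebesgue. norm (f x * p n x) \<le> indicator (cball 0 (R + 1)) x *\<^sub>R (\<bar>f x\<bar> * L)" for n
      proof (rule AE_I2)
        fix x
        show "norm (f x * p n x) \<le> indicator (cball 0 (R + 1)) x *\<^sub>R (\<bar>f x\<bar> * L)"
          using p_bound[of n x] p_out[of x n]
          by (cases "norm x > R + 1") (auto simp: abs_mult intro: mult_left_mono)
      qed
    qed
    then have "(\<lambda>n. LINT x|lebesgue. q n x * \<phi> x) \<longlonglongrightarrow> - (LINT x|lebesgue. f x * partial i \<phi> x)"
      unfolding shift by (rule tendsto_minus)
    ultimately have "(LINT x|lebesgue. g x * \<phi> x) = - (LINT x|lebesgue. f x * partial i \<phi> x)"
      by (rule LIMSEQ_unique)
    then show ?thesis by simp
  qed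
  with lf lg show ?thesis by (simp add: has_weak_partial_def)
qed

subsection \<open>Cells and the order of the coordinates\<close>

text \<open>On distinct indices this merges the strict and weak cases of \<open>less_perm\<close>
  into a relation that no longer depends on the permutation, so that sorting by it makes
  sense.\<close>

definition precedes :: "real ^ 'n::{finite,linorder} \<Rightarrow> 'n::{finite,linorder} \<Rightarrow> 'n::{finite,linorder} \<Rightarrow> bool" where
  "precedes x i j \<longleftrightarrow> x $ j < x $ i \<or> x $ j = x $ i \<and> j < i"

lemma precedes_irrefl: "\<not> precedes x i i"
  and precedes_trans: "precedes x i j \<Longrightarrow> precedes x j k \<Longrightarrow> precedes x i k"
  and precedes_total: "i \<noteq> j \<Longrightarrow> precedes x i j \<or> precedes x j i"
  by (auto simp: precedes_def)

text \<open>The inverse of this rank is the sorting permutation; \<open>Suc\<close> lets ranks start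
  at 1 as path positions do.\<close>

definition coord_rank :: "real ^ 'n::{finite,linorder} \<Rightarrow> 'n::{finite,linorder} \<Rightarrow> nat" where
  "coord_rank x i = Suc (card {k. precedes x k i})"

lemma coord_rank_less: "precedes x i j \<Longrightarrow> coord_rank x i < coord_rank x j"
proof -
  assume *: "precedes x i j"
  have "i \<in> {k. precedes x k j}" "i \<notin> {k. precedes x k i}"
    using * precedes_irrefl by auto
  moreover have "{k. precedes x k i} \<subseteq> {k. precedes x k j}" using * precedes_trans by auto
  ultimately have "{k. precedes x k i} \<subset> {k. precedes x k j}" by blast
  then show ?thesis unfolding coord_rank_def by (intro Suc_mono psubset_card_mono) auto
qed

lemma coord_rank_less_iff: "coord_rank x i < coord_rank x j \<longleftrightarrow> precedes x i j"
  using coord_rank_less precedes_total less_asym less_irrefl by metis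

lemma inj_coord_rank: "inj (coord_rank x)"
  using coord_rank_less precedes_total less_irrefl unfolding inj_def by metis

lemma bij_betw_coord_rank:
  fixes x :: "real ^ 'n::{finite,linorder}"
  shows "bij_betw (coord_rank x) UNIV {1..CARD('n)}"
proof -
  have "coord_rank x i \<le> CARD('n)" for i
  proof -
    have "card {k. precedes x k i} < CARD('n)"
      using precedes_irrefl[of x i] by (intro psubset_card_mono) auto
    then show ?thesis by (simp add: coord_rank_def)
  qed
  then have "range (coord_rank x) \<subseteq> {1..CARD('n)}" by (auto simp: coord_rank_def)
  then have "range (coord_rank x) = {1..CARD('n)}"
    using card_image[OF inj_coord_rank, of x] by (intro card_subset_eq) auto
  then show ?thesis by (simp add: bij_betw_def inj_coord_rank)
qed

lemma perms_bij:
  assumes "\<sigma> \<in> (perms :: (nat \<Rightarrow> 'n::finite) set)"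
  shows "bij_betw \<sigma> {1..CARD('n)} UNIV" "inj_on \<sigma> {1..CARD('n)}"
    and "\<exists>j\<in>{1..CARD('n)}. k = \<sigma> j"
proof -
  show b: "bij_betw \<sigma> {1..CARD('n)} UNIV" using assms by (simp add: perms_def)
  then show "inj_on \<sigma> {1..CARD('n)}" by (rule bij_betw_imp_inj_on)
  have "k \<in> \<sigma> ` {1..CARD('n)}" using b by (simp add: bij_betw_imp_surj_on)
  then show "\<exists>j\<in>{1..CARD('n)}. k = \<sigma> j" by blast
qed

lemma perms_eq_iff:
  assumes "\<sigma> \<in> (perms :: (nat \<Rightarrow> 'n::finite) set)" "i \<in> {1..CARD('n)}" "j \<in> {1..CARD('n)}"
  shows "\<sigma> i = \<sigma> j \<longleftrightarrow> i = j"
  using perms_bij(2)[OF assms(1)] assms(2,3) by (simp add: inj_on_eq_iff)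

lemma finite_unit_paths: "finite (unit_paths :: (nat \<Rightarrow> real ^ 'n::finite) set)"
proof -
  have "(perms :: (nat \<Rightarrow> 'n) set) \<subseteq> {1..CARD('n)} \<rightarrow>\<^sub>E UNIV" by (auto simp: perms_def PiE_def)
  then have "finite (perms :: (nat \<Rightarrow> 'n) set)" by (rule finite_subset) (simp add: finite_PiE)
  then show ?thesis by (simp add: unit_paths_def)
qed

text \<open>Neighbouring entries of a permutation are distinct, so where the index does not increase
  it strictly drops, and equal values are then exactly the tie that \<open>precedes\<close>
  accepts.\<close>

lemma unit_cell_iff_precedes:
  fixes x :: "real ^ 'n::{finite,linorder}"
  assumes "\<sigma> \<in> perms"
  shows "x \<in> unit_cell (unit_path \<sigma>) \<longleftrightarrow>
    0 \<le> x $ \<sigma> CARD('n) \<and> (\<forall>i\<in>{2..CARD('n)}. precedes x (\<sigma> (i - 1)) (\<sigma> i)) \<and> x $ \<sigma> 1 < 1"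
proof -
  have "less_perm \<sigma> i (x $ \<sigma> i) (x $ \<sigma> (i - 1)) \<longleftrightarrow> precedes x (\<sigma> (i - 1)) (\<sigma> i)"
    if "i \<in> {2..CARD('n)}" for i
  proof -
    obtain l where "i = Suc l" "l \<in> {1..CARD('n)}" using \<open>i \<in> {2..CARD('n)}\<close> by (cases i) auto
    then have "\<sigma> (i - 1) \<noteq> \<sigma> i" using that perms_eq_iff[OF assms, of l i] by auto
    then show ?thesis by (auto simp: less_perm_def precedes_def)
  qed
  then show ?thesis by (simp add: unit_cell_def Let_def unit_perm_unit_path[OF assms])
qed

lemma unit_cell_precedes:
  fixes x :: "real ^ 'n::{finite,linorder}"
  assumes "\<sigma> \<in> perms" "x \<in> unit_cell (unit_path \<sigma>)" "1 \<le> i" "i < j" "j \<le> CARD('n)"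
  shows "precedes x (\<sigma> i) (\<sigma> j)"
  using assms(4,3,5)
proof (induction i j rule: less_Suc_induct)
  case (1 i)
  have "\<forall>i\<in>{2..CARD('n)}. precedes x (\<sigma> (i - 1)) (\<sigma> i)"
    using assms(2) unit_cell_iff_precedes[OF assms(1), of x] by blast
  from bspec[OF this, of "Suc i"] 1 show ?case by simp
next
  case (2 i j k)
  then show ?case using precedes_trans[of x "\<sigma> i" "\<sigma> j" "\<sigma> k"] by simp
qed

lemma unit_cell_antimono:
  fixes x :: "real ^ 'n::{finite,linorder}"
  assumes "\<sigma> \<in> perms" "x \<in> unit_cell (unit_path \<sigma>)" "1 \<le> i" "i \<le> j" "j \<le> CARD('n)"
  shows "x $ \<sigma> j \<le> x $ \<sigma> i"
  using unit_cell_precedes[OF assms(1,2,3), of j] assms(4,5)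
  by (cases "i = j") (auto simp: precedes_def)

lemma unit_cell_bounds:
  fixes x :: "real ^ 'n::{finite,linorder}"
  assumes "\<sigma> \<in> perms" "x \<in> unit_cell (unit_path \<sigma>)"
  shows "0 \<le> x $ k" "x $ k < 1"
proof -
  obtain j where "j \<in> {1..CARD('n)}" "k = \<sigma> j" using perms_bij(3)[OF assms(1)] by blast
  then show "0 \<le> x $ k" "x $ k < 1"
    using unit_cell_antimono[OF assms, of j "CARD('n)"] unit_cell_antimono[OF assms, of 1 j]
      assms(2) unit_cell_iff_precedes[OF assms(1), of x] by auto
qed

lemma ex_unit_cell:
  fixes x :: "real ^ 'n::{finite,linorder}"
  assumes "\<And>k. 0 \<le> x $ k" "\<And>k. x $ k < 1"
  shows "\<exists>\<sigma>\<in>perms. x \<in> unit_cell (unit_path \<sigma>)"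
proof -
  define \<sigma> where "\<sigma> = restrict (inv_into UNIV (coord_rank x)) {1..CARD('n)}"
  note b = bij_betw_coord_rank[of x]
  have "bij_betw \<sigma> {1..CARD('n)} UNIV"
    using bij_betw_inv_into[OF b] by (rule bij_betw_cong[THEN iffD1, rotated]) (simp add: \<sigma>_def)
  then have \<sigma>: "\<sigma> \<in> perms" by (simp add: perms_def \<sigma>_def)
  have rank: "coord_rank x (\<sigma> i) = i" if "i \<in> {1..CARD('n)}" for i
    using that bij_betw_inv_into_right[OF b] by (simp add: \<sigma>_def)
  have "precedes x (\<sigma> (i - 1)) (\<sigma> i)" if "i \<in> {2..CARD('n)}" for i
  proof -
    obtain l where "i = Suc l" "l \<in> {1..CARD('n)}" using \<open>i \<in> {2..CARD('n)}\<close> by (cases i) auto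
    then show ?thesis
      using that rank[of i] rank[of l] by (subst coord_rank_less_iff[symmetric]) auto
  qed
  then have "x \<in> unit_cell (unit_path \<sigma>)"
    using assms by (simp add: unit_cell_iff_precedes[OF \<sigma>])
  with \<sigma> show ?thesis by blast
qed

text \<open>The entries preceding \<open>\<sigma> j\<close> are exactly those at earlier positions.
  Hence any cell containing \<open>x\<close> has the inverse rank as its permutation, which gives
  uniqueness of the cell.\<close>

lemma coord_rank_unit_cell:
  fixes x :: "real ^ 'n::{finite,linorder}"
  assumes "\<sigma> \<in> perms" "x \<in> unit_cell (unit_path \<sigma>)" "j \<in> {1..CARD('n)}"
  shows "coord_rank x (\<sigma> j) = j"
proof -
  have "{k. precedes x k (\<sigma> j)} = \<sigma> ` {1..<j}"
  proof (intro set_eqI iffI)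
    fix k assume k: "k \<in> {k. precedes x k (\<sigma> j)}"
    obtain i where i: "i \<in> {1..CARD('n)}" "k = \<sigma> i" using perms_bij(3)[OF assms(1)] by blast
    have "\<not> j \<le> i"
      using k i unit_cell_precedes[OF assms(1,2), of j i] assms(3)
        precedes_trans[of x "\<sigma> i" "\<sigma> j" "\<sigma> i"] precedes_irrefl[of x "\<sigma> i"]
      by (cases "i = j") auto
    then show "k \<in> \<sigma> ` {1..<j}" using i by auto
  qed (use assms unit_cell_precedes[OF assms(1,2)] in auto)
  moreover have "card (\<sigma> ` {1..<j}) = j - 1"
    using assms(3) by (subst card_image) (auto intro!: inj_on_subset[OF perms_bij(2)[OF assms(1)]])
  ultimately show ?thesis using assms(3) by (simp add: coord_rank_def)
qed

lemma unit_cell_unique: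
  fixes x :: "real ^ 'n::{finite,linorder}"
  assumes "\<sigma> \<in> perms" "x \<in> unit_cell (unit_path \<sigma>)" "\<tau> \<in> perms" "x \<in> unit_cell (unit_path \<tau>)"
  shows "\<sigma> = \<tau>"
proof (rule extensionalityI[of _ "{1..CARD('n)}"])
  show "\<sigma> \<in> extensional {1..CARD('n)}" "\<tau> \<in> extensional {1..CARD('n)}"
    using assms by (auto simp: perms_def)
  fix j assume "j \<in> {1..CARD('n)}"
  then have "coord_rank x (\<sigma> j) = coord_rank x (\<tau> j)" using assms by (simp add: coord_rank_unit_cell)
  then show "\<sigma> j = \<tau> j" by (rule injD[OF inj_coord_rank])
qed

text \<open>Needed because a partition has no empty block. The witness puts the values 1 - j/(d+1)
  along the path, strictly decreasing inside (0,1).\<close>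

lemma unit_cell_nonempty:
  fixes \<sigma> :: "nat \<Rightarrow> 'n::{finite,linorder}"
  assumes "\<sigma> \<in> perms"
  shows "\<exists>x. x \<in> unit_cell (unit_path \<sigma>)"
proof
  define x :: "real ^ 'n::{finite,linorder}" where
    "x = (\<chi> k. 1 - real (inv_into {1..CARD('n)} \<sigma> k) / real (Suc CARD('n)))"
  have x: "x $ \<sigma> j = 1 - real j / real (Suc CARD('n))" if "j \<in> {1..CARD('n)}" for j
    using inv_into_f_f[OF perms_bij(2)[OF assms] that] by (simp add: x_def)
  have "precedes x (\<sigma> (i - 1)) (\<sigma> i)" if "i \<in> {2..CARD('n)}" for i
  proof -
    obtain l where "i = Suc l" "l \<in> {1..CARD('n)}" using \<open>i \<in> {2..CARD('n)}\<close> by (cases i) auto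
    then show ?thesis
      using that x[of i] x[of l] by (auto simp: precedes_def divide_strict_right_mono)
  qed
  then show "x \<in> unit_cell (unit_path \<sigma>)"
    using x[of 1] x[of "CARD('n)"] by (simp add: unit_cell_iff_precedes[OF assms] Suc_leI)
qed

subsection \<open>The primal tent function\<close>

lemma unit_path_nth:
  assumes "\<sigma> \<in> (perms :: (nat \<Rightarrow> 'n::finite) set)" "i \<le> CARD('n)" "j \<in> {1..CARD('n)}"
  shows "(unit_path \<sigma> i :: real ^ 'n) $ \<sigma> j = (if j \<le> i then 1 else 0)"
proof -
  have "(unit_path \<sigma> i :: real ^ 'n) $ \<sigma> j = (\<Sum>l = 1..i. if l = j then 1 else 0)"
    using assms perms_eq_iff[OF assms(1), of j]
    by (auto simp: unit_path_def axis_def intro!: sum.cong)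
  then show ?thesis using assms by (simp add: sum.delta)
qed

lemma unit_path_inject:
  assumes "\<sigma> \<in> (perms :: (nat \<Rightarrow> 'n::finite) set)" "i \<le> CARD('n)" "j \<le> CARD('n)"
    and eq: "(unit_path \<sigma> i :: real ^ 'n) = unit_path \<sigma> j"
  shows "i = j"
proof -
  have *: False if "i < j" "j \<le> CARD('n)" "(unit_path \<sigma> i :: real ^ 'n) = unit_path \<sigma> j" for i j
    using that unit_path_nth[OF assms(1), of i j] unit_path_nth[OF assms(1), of j j] by simp
  then show ?thesis using assms by (metis linorder_neqE_nat)
qed

lemma unit_path_in_lattice:
  assumes "\<sigma> \<in> (perms :: (nat \<Rightarrow> 'n::finite) set)" "i \<le> CARD('n)"
  shows "(unit_path \<sigma> i :: real ^ 'n) \<in> lattice_pts 1"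
  unfolding lattice_pts_def
proof (intro CollectI allI)
  fix k
  obtain j where "j \<in> {1..CARD('n)}" "k = \<sigma> j" using perms_bij(3)[OF assms(1)] by blast
  then show "\<exists>m::int. (unit_path \<sigma> i :: real ^ 'n) $ k = 1 * of_int m"
    using unit_path_nth[OF assms, of j] by (auto intro: exI[of _ 0] exI[of _ 1])
qed

lemma lattice_pts_add: "\<alpha> \<in> lattice_pts r \<Longrightarrow> \<beta> \<in> lattice_pts r \<Longrightarrow> \<alpha> + \<beta> \<in> lattice_pts r"
  unfolding lattice_pts_def by simp (metis distrib_left of_int_add)

lemma lattice_pts_minus: "\<alpha> \<in> lattice_pts r \<Longrightarrow> - \<alpha> \<in> lattice_pts r"
  unfolding lattice_pts_def by simp (metis mult_minus_right of_int_minus)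

lemma lattice_pts_diff: "\<alpha> \<in> lattice_pts r \<Longrightarrow> \<beta> \<in> lattice_pts r \<Longrightarrow> \<alpha> - \<beta> \<in> lattice_pts r"
  using lattice_pts_add[OF _ lattice_pts_minus] by fastforce

lemma lattice_pts_eq_0:
  assumes "\<gamma> \<in> lattice_pts 1" "\<And>k. 0 \<le> y $ k" "\<And>k. y $ k < 1"
    and "\<And>k. 0 \<le> (y + \<gamma>) $ k" "\<And>k. (y + \<gamma>) $ k < 1"
  shows "\<gamma> = 0"
proof (rule vec_eq_iff[THEN iffD2], rule allI)
  fix k
  obtain m :: int where m: "\<gamma> $ k = of_int m" using assms(1) by (auto simp: lattice_pts_def)
  have "- 1 < \<gamma> $ k" "\<gamma> $ k < 1"
    using assms(2)[of k] assms(3)[of k] assms(4)[of k] assms(5)[of k] by auto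
  then have "m = 0" using m by linarith
  then show "\<gamma> $ k = 0 $ k" using m by simp
qed

text \<open>If an indicator in \<open>tent_unit\<close> is nonzero, then
  \<open>y + \<beta> + T i\<close> and \<open>y\<close> both lie in the half-open unit cube and
  differ by an integer vector, so they coincide. Then \<open>T i = - \<beta>\<close> and, cells
  being disjoint, \<open>T\<close> is the path of \<open>y\<close>; the outer sum collapses.\<close>

lemma tent_unit_on_cell:
  fixes y \<beta> :: "real ^ 'n::{finite,linorder}"
  assumes \<sigma>: "\<sigma> \<in> perms" and y: "y \<in> unit_cell (unit_path \<sigma>)" and \<beta>: "\<beta> \<in> lattice_pts 1"
  shows "tent_unit (y + \<beta>) =
    (\<Sum>i=0..CARD('n). if unit_path \<sigma> i = - \<beta> then height (unit_path \<sigma>) i y else 0)"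
proof -
  have summand: "indicator (unit_cell T) (y + \<beta> + T i) * height T i (y + \<beta> + T i) =
      (if T = unit_path \<sigma> \<and> T i = - \<beta> then height T i y else 0)"
    if T: "T \<in> unit_paths" and i: "i \<in> {0..CARD('n)}" for T i
  proof (cases "y + \<beta> + T i \<in> unit_cell T")
    case True
    obtain \<tau> where \<tau>: "\<tau> \<in> perms" "T = unit_path \<tau>" using T by (auto simp: unit_paths_def)
    have "\<beta> + T i = 0"
    proof (rule lattice_pts_eq_0[where y = y])
      show "\<beta> + T i \<in> lattice_pts 1"
        using i \<tau> by (auto intro!: lattice_pts_add \<beta> unit_path_in_lattice)
    qed (use unit_cell_bounds[OF \<sigma> y] unit_cell_bounds[OF \<tau>(1) True[unfolded \<tau>(2)]] \<tau>(2)
        in \<open>auto simp: add.assoc\<close>)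
    then have *: "T i = - \<beta>" "y + \<beta> + T i = y" by (auto simp: add.assoc eq_neg_iff_add_eq_0 add.commute)
    with True have "y \<in> unit_cell (unit_path \<tau>)" by (simp add: \<tau>(2))
    then have "\<tau> = \<sigma>" using unit_cell_unique[OF \<tau>(1) _ \<sigma> y] by blast
    with True * show ?thesis by (simp add: \<tau>(2))
  next
    case False
    then have "\<not> (T = unit_path \<sigma> \<and> T i = - \<beta>)" using y by auto
    with False show ?thesis by auto
  qed
  have "tent_unit (y + \<beta>) =
      (\<Sum>T\<in>unit_paths. \<Sum>i=0..CARD('n). if T = unit_path \<sigma> \<and> T i = - \<beta> then height T i y else 0)"
    unfolding tent_unit_def by (intro sum.cong refl summand) auto
  also have "\<dots> = (\<Sum>T\<in>unit_paths. if T = unit_path \<sigma>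
      then (\<Sum>i=0..CARD('n). if unit_path \<sigma> i = - \<beta> then height (unit_path \<sigma>) i y else 0) else 0)"
    by (intro sum.cong) auto
  also have "\<dots> = (\<Sum>i=0..CARD('n). if unit_path \<sigma> i = - \<beta> then height (unit_path \<sigma>) i y else 0)"
  proof -
    have "unit_path \<sigma> \<in> unit_paths" using \<sigma> by (simp add: unit_paths_def)
    then show ?thesis by (simp add: finite_unit_paths)
  qed
  finally show ?thesis .
qed

text \<open>With 0 included, \<open>max_coord (- x)\<close> is minus the minimum of 0 and the
  coordinates, so \<open>max_coord x + max_coord (- x)\<close> is the spread of the numbers 0,
  \<open>x $ k\<close>.\<close>

definition max_coord :: "real ^ 'n::finite \<Rightarrow> real" where
  "max_coord x = Max (insert 0 (range (($) x)))"

lemma max_coord_ge: "0 \<le> max_coord x" "x $ k \<le> max_coord x"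
  unfolding max_coord_def by (intro Max_ge; simp)+

lemma max_coord_leI: "0 \<le> c \<Longrightarrow> (\<And>k. x $ k \<le> c) \<Longrightarrow> max_coord x \<le> c"
  by (auto simp: max_coord_def)

lemma max_coord_lipschitz: "\<bar>max_coord x - max_coord y\<bar> \<le> norm (x - y)"
proof -
  have *: "max_coord x \<le> max_coord y + norm (x - y)" for x y :: "real ^ 'n"
  proof (rule max_coord_leI)
    show "0 \<le> max_coord y + norm (x - y)" using max_coord_ge(1)[of y] by simp
    show "x $ k \<le> max_coord y + norm (x - y)" for k
      using max_coord_ge(2)[of y k] component_le_norm_cart[of "x - y" k] by simp
  qed
  show ?thesis using *[of x y] *[of y x] by (simp add: norm_minus_commute abs_le_iff)
qed

text \<open>The tent function is piecewise linear, and on each cell of its support the largest and the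
  smallest of \<open>0, x\<^sub>1, \<dots>, x\<^sub>d\<close> are attained at neighbouring positions of the path.\<close>

lemma tent_unit_eq:
  fixes x :: "real ^ 'n::{finite,linorder}"
  shows "tent_unit x = max 0 (1 - max_coord x - max_coord (- x))"
proof -
  define \<beta> :: "real ^ 'n::{finite,linorder}" where "\<beta> = (\<chi> k. of_int \<lfloor>x $ k\<rfloor>)"
  define y where "y = x - \<beta>"
  have x: "x = y + \<beta>" by (simp add: y_def)
  have \<beta>: "\<beta> \<in> lattice_pts 1" by (auto simp: \<beta>_def lattice_pts_def)
  have "0 \<le> y $ k" "y $ k < 1" for k by (simp_all add: y_def \<beta>_def) linarith+
  then obtain \<sigma> where \<sigma>: "\<sigma> \<in> perms" and y: "y \<in> unit_cell (unit_path \<sigma>)"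
    using ex_unit_cell by blast
  note y_bounds = unit_cell_bounds[OF \<sigma> y] and y_mono = unit_cell_antimono[OF \<sigma> y]
  have tent: "tent_unit x = (\<Sum>i=0..CARD('n). if unit_path \<sigma> i = - \<beta> then height (unit_path \<sigma>) i y else 0)"
    unfolding x by (rule tent_unit_on_cell[OF \<sigma> y \<beta>])
  have card: "CARD('n) > 0" by simp
  show ?thesis
  proof (cases "\<exists>i\<le>CARD('n). unit_path \<sigma> i = - \<beta>")
    case True
    then obtain i where i: "i \<le> CARD('n)" "unit_path \<sigma> i = - \<beta>" by blast
    have "unit_path \<sigma> l = - \<beta> \<longleftrightarrow> l = i" if "l \<in> {0..CARD('n)}" for l
      using that i unit_path_inject[OF \<sigma>, of l i] by auto
    then have "tent_unit x = (\<Sum>l=0..CARD('n). if l = i then height (unit_path \<sigma>) i y else 0)"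
      unfolding tent by (intro sum.cong) auto
    then have h: "tent_unit x = height (unit_path \<sigma>) i y" using i by simp
    have x_nth: "x $ \<sigma> j = y $ \<sigma> j - (if j \<le> i then 1 else 0)" if "j \<in> {1..CARD('n)}" for j
    proof -
      have "\<beta> = - unit_path \<sigma> i" using i by simp
      then show ?thesis using unit_path_nth[OF \<sigma> i(1) that] by (simp add: x)
    qed
    \<comment> \<open>Positions up to \<open>i\<close> carry y - 1 < 0, later ones carry y \<ge> 0,
      and y decreases along the path. The maximum is therefore at position i + 1 and the minimum at
      position i, with 0 where no such position exists.\<close>
    have up: "max_coord x = (if i < CARD('n) then y $ \<sigma> (Suc i) else 0)"
    proof (rule antisym)
      show "max_coord x \<le> (if i < CARD('n) then y $ \<sigma> (Suc i) else 0)"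
      proof (rule max_coord_leI)
        fix k
        obtain j where j: "j \<in> {1..CARD('n)}" "k = \<sigma> j" using perms_bij(3)[OF \<sigma>] by blast
        show "x $ k \<le> (if i < CARD('n) then y $ \<sigma> (Suc i) else 0)"
          using j x_nth[OF j(1)] y_bounds(2)[of "\<sigma> j"] y_bounds(1)[of "\<sigma> (Suc i)"] y_mono[of "Suc i" j]
          by (cases "j \<le> i") auto
      qed (use y_bounds in auto)
      show "(if i < CARD('n) then y $ \<sigma> (Suc i) else 0) \<le> max_coord x"
        using max_coord_ge(1)[of x] max_coord_ge(2)[of x "\<sigma> (Suc i)"] x_nth[of "Suc i"] by auto
    qed
    have lo: "max_coord (- x) = (if i = 0 then 0 else 1 - y $ \<sigma> i)"
    proof (rule antisym)
      show "max_coord (- x) \<le> (if i = 0 then 0 else 1 - y $ \<sigma> i)"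
      proof (rule max_coord_leI)
        fix k
        obtain j where j: "j \<in> {1..CARD('n)}" "k = \<sigma> j" using perms_bij(3)[OF \<sigma>] by blast
        show "(- x) $ k \<le> (if i = 0 then 0 else 1 - y $ \<sigma> i)"
          using j i x_nth[OF j(1)] y_bounds(2)[of "\<sigma> i"] y_bounds(1)[of "\<sigma> j"] y_mono[of j i]
          by (cases "j \<le> i") auto
      qed (use y_bounds[of "\<sigma> i"] in auto)
      show "(if i = 0 then 0 else 1 - y $ \<sigma> i) \<le> max_coord (- x)"
        using max_coord_ge(1)[of "- x"] max_coord_ge(2)[of "- x" "\<sigma> i"] x_nth[of i] i by auto
    qed
    have "height (unit_path \<sigma>) i y = 1 - max_coord x - max_coord (- x)"
      using i card by (auto simp: up lo height_def Let_def unit_perm_unit_path[OF \<sigma>])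
    moreover have "0 \<le> height (unit_path \<sigma>) i y"
      using i card y_bounds(1) y_bounds(2)[of "\<sigma> 1"] y_mono[of i "i + 1"]
      by (auto simp: height_def Let_def unit_perm_unit_path[OF \<sigma>] less_imp_le)
    ultimately show ?thesis by (simp add: h)
  next
    case False
    \<comment> \<open>Positivity would force the spread below 1. The floors are then -1 or 0, and
      negative coordinates have larger fractional parts than nonnegative ones, so they come first
      along the path and \<open>- \<beta>\<close> is one of its vertices.\<close>
    have "1 - max_coord x - max_coord (- x) \<le> 0"
    proof (rule ccontr)
      assume "\<not> ?thesis"
      then have small: "max_coord x + max_coord (- x) < 1" by simp
      have xk: "x $ k < 1" "- 1 < x $ k" "x $ k - x $ l < 1" for k l
        using small max_coord_ge(1)[of x] max_coord_ge(1)[of "- x"]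
          max_coord_ge(2)[of x k] max_coord_ge(2)[of "- x" k] max_coord_ge(2)[of "- x" l] by auto
      have \<beta>k: "\<beta> $ k = (if x $ k < 0 then - 1 else 0)" for k
      proof -
        have "\<lfloor>x $ k\<rfloor> = (if x $ k < 0 then - 1 else 0)"
          using xk(1,2)[of k] by (auto simp: floor_eq_iff)
        then show ?thesis by (simp add: \<beta>_def)
      qed
      define S where "S = {j \<in> {1..CARD('n)}. x $ \<sigma> j < 0}"
      \<comment> \<open>The last position with a negative coordinate; 0, the starting vertex, stands
        for no negative coordinate.\<close>
      define i where "i = (if S = {} then 0 else Max S)"
      have "finite S" by (simp add: S_def)
      then have i_S: "i \<in> S" if "i \<noteq> 0" using that Max_in[of S] by (auto simp: i_def split: if_splits)
      have S_i: "j \<le> i" if "j \<in> S" for j using that \<open>finite S\<close> by (auto simp: i_def)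
      have i_le: "i \<le> CARD('n)" using i_S by (cases "i = 0") (auto simp: S_def)
      have "unit_path \<sigma> i $ k = (- \<beta>) $ k" for k
      proof -
        obtain j where j: "j \<in> {1..CARD('n)}" "k = \<sigma> j" using perms_bij(3)[OF \<sigma>] by blast
        have "x $ \<sigma> j < 0 \<longleftrightarrow> j \<le> i"
        proof
          assume "x $ \<sigma> j < 0"
          then show "j \<le> i" using j S_i by (auto simp: S_def)
        next
          assume "j \<le> i"
          then have iS: "i \<in> S" using i_S j by auto
          show "x $ \<sigma> j < 0"
          proof (rule ccontr)
            assume nonneg: "\<not> x $ \<sigma> j < 0"
            have "y $ \<sigma> i \<le> y $ \<sigma> j" using y_mono[of j i] j \<open>j \<le> i\<close> i_le by simp
            moreover have "y $ \<sigma> j = x $ \<sigma> j" "y $ \<sigma> i = x $ \<sigma> i + 1"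
              using nonneg iS by (auto simp: y_def \<beta>k S_def)
            ultimately show False using xk(3)[of "\<sigma> j" "\<sigma> i"] by simp
          qed
        qed
        then show ?thesis using j unit_path_nth[OF \<sigma> i_le j(1)] by (simp add: \<beta>k)
      qed
      then have "unit_path \<sigma> i = - \<beta>" by (simp add: vec_eq_iff)
      with False i_le show False by blast
    qed
    moreover have "tent_unit x = 0" unfolding tent using False by (intro sum.neutral) auto
    ultimately show ?thesis by simp
  qed
qed

lemma tent_unit_bounds:
  fixes x :: "real ^ 'n::{finite,linorder}"
  shows "0 \<le> tent_unit x" "tent_unit x \<le> 1"
  using max_coord_ge(1)[of x] max_coord_ge(1)[of "- x"] by (auto simp: tent_unit_eq)

lemma tent_unit_eq_0:
  fixes x :: "real ^ 'n::{finite,linorder}"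
  assumes "1 \<le> \<bar>x $ k\<bar>"
  shows "tent_unit x = 0"
  using assms max_coord_ge(1)[of x] max_coord_ge(1)[of "- x"] max_coord_ge(2)[of x k]
    max_coord_ge(2)[of "- x" k]
  by (auto simp: tent_unit_eq abs_if split: if_splits)

text \<open>Each of the two maxima contributes 1 to the constant.\<close>

lemma tent_unit_lipschitz:
  fixes x y :: "real ^ 'n::{finite,linorder}"
  shows "\<bar>tent_unit x - tent_unit y\<bar> \<le> 2 * norm (x - y)"
  using max_coord_lipschitz[of x y] max_coord_lipschitz[of "- x" "- y"]
  by (auto simp: tent_unit_eq norm_minus_commute max_def abs_if split: if_splits)

subsection \<open>Scaled cells and tent functions\<close>

lemma tent_bounds:
  fixes x :: "real ^ 'n::{finite,linorder}"
  shows "0 \<le> tent r \<alpha> x" "tent r \<alpha> x \<le> 1"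
  by (simp_all add: tent_def tent_unit_bounds)

lemma tent_eq_0:
  fixes x :: "real ^ 'n::{finite,linorder}"
  assumes "r > 0" "r \<le> \<bar>x $ k - \<alpha> $ k\<bar>"
  shows "tent r \<alpha> x = 0"
proof -
  have "1 \<le> \<bar>((x - \<alpha>) /\<^sub>R r) $ k\<bar>"
    using assms by (simp add: abs_mult divide_inverse[symmetric] mult.commute[of "inverse r"])
  then show ?thesis unfolding tent_def by (rule tent_unit_eq_0)
qed

lemma support_tent:
  fixes \<alpha> :: "real ^ 'n::{finite,linorder}"
  assumes "r > 0"
  shows "closure {x. tent r \<alpha> x \<noteq> 0} \<subseteq> {\<alpha> + y | y. \<forall>i. y $ i \<in> {-r..r}}"
proof -
  have box: "{\<alpha> + y | y. \<forall>i. y $ i \<in> {-r..r}} = cbox (\<alpha> - (\<chi> i. r)) (\<alpha> + (\<chi> i. r))" (is "?A = ?B")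
  proof (intro set_eqI iffI)
    fix x assume "x \<in> ?B"
    then have "\<forall>i. (x - \<alpha>) $ i \<in> {-r..r}" by (auto simp: mem_box_cart algebra_simps)
    moreover have "x = \<alpha> + (x - \<alpha>)" by simp
    ultimately show "x \<in> ?A" by blast
  qed (auto simp: mem_box_cart)
  have "{x. tent r \<alpha> x \<noteq> 0} \<subseteq> ?B"
  proof
    fix x assume "x \<in> {x. tent r \<alpha> x \<noteq> 0}"
    then have "\<bar>x $ i - \<alpha> $ i\<bar> < r" for i using tent_eq_0[OF assms] not_le by blast
    then show "x \<in> ?B" by (auto simp: mem_box_cart abs_less_iff algebra_simps less_imp_le)
  qed
  then show ?thesis unfolding box by (intro closure_minimal closed_cbox)
qed

lemma tent_lipschitz:
  fixes \<alpha> :: "real ^ 'n::{finite,linorder}"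
  assumes "r > 0"
  shows "(2 / r)-lipschitz_on S (tent r \<alpha>)"
proof (rule lipschitz_onI)
  fix x y :: "real ^ 'n::{finite,linorder}"
  have "(x - \<alpha>) /\<^sub>R r - (y - \<alpha>) /\<^sub>R r = (x - y) /\<^sub>R r"
    by (simp add: scaleR_diff_right[symmetric])
  then show "dist (tent r \<alpha> x) (tent r \<alpha> y) \<le> 2 / r * dist x y"
    using tent_unit_lipschitz[of "(x - \<alpha>) /\<^sub>R r" "(y - \<alpha>) /\<^sub>R r"] assms
    by (simp add: tent_def dist_norm divide_inverse mult.assoc)
qed (use assms in simp)

lemma continuous_on_tent:
  fixes \<alpha> :: "real ^ 'n::{finite,linorder}"
  assumes "r > 0"
  shows "continuous_on S (tent r \<alpha>)"
  using lipschitz_on_continuous_on[OF tent_lipschitz[OF assms]] .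

section \<open>Rescaled cells and the partition of space\<close>

lemma lattice_pts_scale: "\<alpha> \<in> lattice_pts 1 \<Longrightarrow> r *\<^sub>R \<alpha> \<in> lattice_pts r"
  unfolding lattice_pts_def by auto

lemma lattice_pts_unscale: "r > 0 \<Longrightarrow> \<alpha> \<in> lattice_pts r \<Longrightarrow> \<alpha> /\<^sub>R r \<in> lattice_pts 1"
  unfolding lattice_pts_def by (auto simp: field_simps)

lemma pathsE:
  fixes T :: "nat \<Rightarrow> real ^ 'n::finite"
  assumes "r > 0" "T \<in> paths r"
  obtains \<beta> \<sigma> where "\<beta> \<in> lattice_pts r" "\<sigma> \<in> perms" "path_parts r T = (\<beta>, unit_path \<sigma>)"
    "path_perm r T = \<sigma>" "\<And>i. i \<le> CARD('n) \<Longrightarrow> T i = \<beta> + r *\<^sub>R unit_path \<sigma> i"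
    "T = scaled_path r (\<beta>, unit_path \<sigma>)"
proof -
  obtain \<beta> \<sigma> where T: "\<beta> \<in> lattice_pts r" "\<sigma> \<in> perms" "T = scaled_path r (\<beta>, unit_path \<sigma>)"
    using assms(2) by (auto simp: paths_def unit_paths_def)
  then have p: "path_parts r T = (\<beta>, unit_path \<sigma>)"
    using path_parts_scaled_path[OF assms(1)] by (auto simp: unit_paths_def)
  show ?thesis
  proof (rule that[OF T(1,2) p _ _ T(3)])
    show "path_perm r T = \<sigma>" by (simp add: path_perm_def p unit_perm_unit_path[OF T(2)])
    show "T i = \<beta> + r *\<^sub>R unit_path \<sigma> i" if "i \<le> CARD('n)" for i
      using that by (simp add: T(3) scaled_path_def)
  qed
qed

lemma mem_cell_iff:
  fixes x :: "real ^ 'n::{finite,linorder}"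
  assumes "r > 0" "path_parts r T = (\<beta>, U)"
  shows "x \<in> cell r T \<longleftrightarrow> (x - \<beta>) /\<^sub>R r \<in> unit_cell U"
proof
  assume "(x - \<beta>) /\<^sub>R r \<in> unit_cell U"
  then show "x \<in> cell r T"
    unfolding cell_def using assms by (intro image_eqI[of _ _ "(x - \<beta>) /\<^sub>R r"]) auto
qed (use assms in \<open>auto simp: cell_def\<close>)

lemma path_in_lattice:
  fixes T :: "nat \<Rightarrow> real ^ 'n::finite"
  assumes "r > 0" "T \<in> paths r" "i \<le> CARD('n)"
  shows "T i \<in> lattice_pts r"
proof -
  obtain \<beta> \<sigma> where "\<beta> \<in> lattice_pts r" "\<sigma> \<in> perms" "T i = \<beta> + r *\<^sub>R unit_path \<sigma> i"
    using pathsE[OF assms(1,2)] assms(3) by metis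
  then show ?thesis
    using assms(3) by (auto intro!: lattice_pts_add lattice_pts_scale unit_path_in_lattice)
qed

text \<open>The lower corner of the half-open lattice cube containing \<open>x\<close>; it is the
  base point of every cell that contains \<open>x\<close>.\<close>

definition lattice_floor :: "real \<Rightarrow> real ^ 'n \<Rightarrow> real ^ 'n::finite" where
  "lattice_floor r x = (\<chi> k. r * of_int \<lfloor>x $ k / r\<rfloor>)"

lemma lattice_floor_in_lattice: "lattice_floor r x \<in> lattice_pts r"
  by (auto simp: lattice_floor_def lattice_pts_def)

lemma lattice_floor_bounds:
  assumes "r > 0"
  shows "0 \<le> x $ k - lattice_floor r x $ k" "x $ k - lattice_floor r x $ k < r"
proof -
  have "of_int \<lfloor>x $ k / r\<rfloor> * r \<le> x $ k" "x $ k < (of_int \<lfloor>x $ k / r\<rfloor> + 1) * r"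
    using assms by (simp_all flip: pos_le_divide_eq pos_divide_less_eq)
  then show "0 \<le> x $ k - lattice_floor r x $ k" "x $ k - lattice_floor r x $ k < r"
    by (simp_all add: lattice_floor_def algebra_simps)
qed

lemma lattice_floor_unique:
  assumes "r > 0" "\<beta> \<in> lattice_pts r"
    and "\<And>k. 0 \<le> x $ k - \<beta> $ k" "\<And>k. x $ k - \<beta> $ k < r"
  shows "\<beta> = lattice_floor r x"
proof (rule vec_eq_iff[THEN iffD2], rule allI)
  fix k
  obtain m :: int where m: "\<beta> $ k = r * of_int m" using assms(2) by (auto simp: lattice_pts_def)
  have "\<lfloor>x $ k / r\<rfloor> = m"
    using assms(1) assms(3,4)[of k] by (simp add: m floor_eq_iff field_simps)
  then show "\<beta> $ k = lattice_floor r x $ k" by (simp add: m lattice_floor_def)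
qed

lemma ex_cell:
  fixes x :: "real ^ 'n::{finite,linorder}"
  assumes "r > 0"
  shows "\<exists>T\<in>paths r. x \<in> cell r T"
proof -
  define \<beta> where "\<beta> = lattice_floor r x"
  have "0 \<le> ((x - \<beta>) /\<^sub>R r) $ k" "((x - \<beta>) /\<^sub>R r) $ k < 1" for k
    using lattice_floor_bounds[OF assms, of x k] assms by (auto simp: \<beta>_def field_simps)
  then obtain \<sigma> where \<sigma>: "\<sigma> \<in> perms" "(x - \<beta>) /\<^sub>R r \<in> unit_cell (unit_path \<sigma>)"
    using ex_unit_cell by blast
  define T where "T = scaled_path r (\<beta>, unit_path \<sigma>)"
  have "unit_path \<sigma> \<in> unit_paths" using \<sigma> by (simp add: unit_paths_def)
  moreover have "\<beta> \<in> lattice_pts r" by (simp add: \<beta>_def lattice_floor_in_lattice)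
  ultimately have "T \<in> paths r" "path_parts r T = (\<beta>, unit_path \<sigma>)"
    using path_parts_scaled_path[OF assms] by (auto simp: T_def paths_def)
  then show ?thesis using mem_cell_iff[OF assms] \<sigma>(2) by blast
qed

lemma cell_unique:
  fixes x :: "real ^ 'n::{finite,linorder}"
  assumes "r > 0" "T \<in> paths r" "U \<in> paths r" "x \<in> cell r T" "x \<in> cell r U"
  shows "T = U"
proof -
  obtain \<beta> \<sigma> where T: "\<beta> \<in> lattice_pts r" "\<sigma> \<in> perms" "path_parts r T = (\<beta>, unit_path \<sigma>)"
    "T = scaled_path r (\<beta>, unit_path \<sigma>)" using pathsE[OF assms(1,2)] by metis
  obtain \<gamma> \<tau> where U: "\<gamma> \<in> lattice_pts r" "\<tau> \<in> perms" "path_parts r U = (\<gamma>, unit_path \<tau>)"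
    "U = scaled_path r (\<gamma>, unit_path \<tau>)" using pathsE[OF assms(1,3)] by metis
  have *: "\<delta> = lattice_floor r x"
    if "\<delta> \<in> lattice_pts r" "\<rho> \<in> perms" "(x - \<delta>) /\<^sub>R r \<in> unit_cell (unit_path \<rho>)" for \<delta> \<rho>
    using unit_cell_bounds[OF that(2,3)] assms(1) that(1)
    by (intro lattice_floor_unique) (auto simp: field_simps)
  have x: "(x - \<beta>) /\<^sub>R r \<in> unit_cell (unit_path \<sigma>)" "(x - \<gamma>) /\<^sub>R r \<in> unit_cell (unit_path \<tau>)"
    using assms mem_cell_iff T(3) U(3) by blast+
  then have "\<beta> = \<gamma>" using * T(1,2) U(1,2) by metis
  moreover from this have "\<sigma> = \<tau>" using x unit_cell_unique T(2) U(2) by blast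
  ultimately show ?thesis by (simp add: T(4) U(4))
qed

lemma cell_nonempty:
  fixes T :: "nat \<Rightarrow> real ^ 'n::{finite,linorder}"
  assumes "r > 0" "T \<in> paths r"
  shows "cell r T \<noteq> {}"
proof -
  obtain \<beta> \<sigma> where "\<sigma> \<in> perms" "path_parts r T = (\<beta>, unit_path \<sigma>)"
    using pathsE[OF assms] by metis
  then show ?thesis using unit_cell_nonempty by (auto simp: cell_def)
qed

text \<open>The set of cells alone would let two paths share a cell; disjointness of the indexed
  family, with cells nonempty, excludes this.\<close>

lemma partition_cells:
  assumes r: "r > 0"
  shows "partition_on (UNIV :: (real ^ 'n::{finite,linorder}) set) (cell r ` paths r)"
    and "disjoint_family_on (cell r :: _ \<Rightarrow> (real ^ 'n::{finite,linorder}) set) (paths r)"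
proof -
  show "disjoint_family_on (cell r :: _ \<Rightarrow> (real ^ 'n::{finite,linorder}) set) (paths r)"
    using cell_unique[OF r] by (auto simp: disjoint_family_on_def)
  show "partition_on (UNIV :: (real ^ 'n::{finite,linorder}) set) (cell r ` paths r)"
  proof (rule partition_onI)
    show "\<Union> (cell r ` paths r) = (UNIV :: (real ^ 'n::{finite,linorder}) set)"
      using ex_cell[OF r] by blast
    show "disjnt C D" if "C \<in> cell r ` paths r" "D \<in> cell r ` paths r" "C \<noteq> D"
      for C D :: "(real ^ 'n::{finite,linorder}) set"
      using that cell_unique[OF r] unfolding disjnt_def by blast
    show "({} :: (real ^ 'n::{finite,linorder}) set) \<notin> cell r ` paths r"
      using cell_nonempty[OF r] by force
  qed
qed

definition cell_at :: "real \<Rightarrow> real ^ 'n::{finite,linorder} \<Rightarrow> nat \<Rightarrow> real ^ 'n::{finite,linorder}" where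
  "cell_at r x = (THE T. T \<in> paths r \<and> x \<in> cell r T)"

lemma cell_at:
  fixes x :: "real ^ 'n::{finite,linorder}"
  assumes "r > 0"
  shows "cell_at r x \<in> paths r" "x \<in> cell r (cell_at r x)"
proof -
  have "\<exists>!T. T \<in> paths r \<and> x \<in> cell r T"
    using ex_cell[OF assms] cell_unique[OF assms] by blast
  from theI'[OF this] show "cell_at r x \<in> paths r" "x \<in> cell r (cell_at r x)"
    by (simp_all add: cell_at_def)
qed

lemma cell_at_eq:
  fixes x :: "real ^ 'n::{finite,linorder}"
  assumes "r > 0" "T \<in> paths r"
  shows "x \<in> cell r T \<longleftrightarrow> cell_at r x = T"
  using cell_at[OF assms(1)] cell_unique[OF assms(1)] assms(2) by blast

text \<open>For a path these are the barycentric coordinates of the simplex with vertices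
  \<open>T 0\<close>, ..., \<open>T d\<close>: affine functions with value 1 at \<open>T i\<close>
  and 0 at the other vertices.\<close>

definition bary :: "real \<Rightarrow> (nat \<Rightarrow> real ^ 'n) \<Rightarrow> nat \<Rightarrow> real ^ 'n::finite \<Rightarrow> real" where
  "bary r T i x = height (snd (path_parts r T)) i ((x - fst (path_parts r T)) /\<^sub>R r)"

text \<open>Rescaling turns \<open>unit_path \<sigma> i = - \<beta>\<close> into the condition that
  the node \<alpha> is vertex \<open>i\<close> of the cell. The conditional sum also covers nodes
  that are no vertex.\<close>

lemma tent_on_cell:
  fixes x :: "real ^ 'n::{finite,linorder}"
  assumes r: "r > 0" and T: "T \<in> paths r" and x: "x \<in> cell r T" and \<alpha>: "\<alpha> \<in> lattice_pts r"
  shows "tent r \<alpha> x = (\<Sum>i=0..CARD('n). if T i = \<alpha> then bary r T i x else 0)"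
proof -
  obtain \<beta> \<sigma> where \<beta>: "\<beta> \<in> lattice_pts r" and \<sigma>: "\<sigma> \<in> perms"
    and p: "path_parts r T = (\<beta>, unit_path \<sigma>)"
    and Ti: "\<And>i. i \<le> CARD('n) \<Longrightarrow> T i = \<beta> + r *\<^sub>R unit_path \<sigma> i"
    using pathsE[OF r T] by metis
  define y where "y = (x - \<beta>) /\<^sub>R r"
  have y: "y \<in> unit_cell (unit_path \<sigma>)" using x mem_cell_iff[OF r p] by (simp add: y_def)
  have "(x - \<alpha>) /\<^sub>R r = y + (\<beta> - \<alpha>) /\<^sub>R r"
    by (simp add: y_def scaleR_add_right[symmetric])
  then have "tent r \<alpha> x = tent_unit (y + (\<beta> - \<alpha>) /\<^sub>R r)" by (simp add: tent_def)
  also have "\<dots> = (\<Sum>i=0..CARD('n). if unit_path \<sigma> i = - ((\<beta> - \<alpha>) /\<^sub>R r) then height (unit_path \<sigma>) i y else 0)"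
    by (intro tent_unit_on_cell \<sigma> y lattice_pts_unscale r lattice_pts_diff \<alpha> \<beta>)
  also have "\<dots> = (\<Sum>i=0..CARD('n). if T i = \<alpha> then bary r T i x else 0)"
  proof (rule sum.cong[OF refl])
    fix i assume "i \<in> {0..CARD('n)}"
    then have "T i = \<alpha> \<longleftrightarrow> r *\<^sub>R unit_path \<sigma> i = \<alpha> - \<beta>" using Ti[of i] by (auto simp: algebra_simps)
    also have "\<dots> \<longleftrightarrow> unit_path \<sigma> i = (\<alpha> - \<beta>) /\<^sub>R r" using r by (simp add: divideR_right)
    finally have "unit_path \<sigma> i = - ((\<beta> - \<alpha>) /\<^sub>R r) \<longleftrightarrow> T i = \<alpha>"
      by (simp add: scaleR_diff_right)
    then show "(if unit_path \<sigma> i = - ((\<beta> - \<alpha>) /\<^sub>R r) then height (unit_path \<sigma>) i y else 0) =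
      (if T i = \<alpha> then bary r T i x else 0)" by (simp add: bary_def p y_def)
  qed
  finally show ?thesis .
qed

text \<open>The heights telescope: up to index m they add up to 1 minus the coordinate at position m
  + 1, and the last height restores the remaining coordinate.\<close>

lemma sum_bary:
  fixes T :: "nat \<Rightarrow> real ^ 'n::finite"
  shows "(\<Sum>i=0..CARD('n). bary r T i x) = 1"
proof -
  define z where "z = (x - fst (path_parts r T)) /\<^sub>R r"
  define U where "U = snd (path_parts r T)"
  have *: "(\<Sum>i=0..m. height U i z) = 1 - z $ unit_perm U (Suc m)" if "m < CARD('n)" for m
    using that by (induction m) (auto simp: height_def Let_def)
  obtain m where m: "CARD('n) = Suc m" using zero_less_card_finite gr0_conv_Suc by metis
  have "(\<Sum>i=0..CARD('n). height U i z) = 1"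
    using *[of m] by (simp add: m) (simp add: height_def Let_def m)
  then show ?thesis by (simp add: bary_def z_def U_def)
qed

section \<open>Pointwise sums of tents and the partition of unity\<close>

lemma has_sum_single:
  fixes f :: "'a \<Rightarrow> real"
  assumes "\<And>y. y \<in> A \<Longrightarrow> y \<noteq> x \<Longrightarrow> f y = 0"
  shows "(f has_sum (if x \<in> A then f x else 0)) A"
  by (rule has_sum_finite_neutralI[where B = "{x} \<inter> A"]) (use assms in auto)

lemma has_sum_sum:
  fixes f :: "'i \<Rightarrow> 'a \<Rightarrow> 'b::topological_comm_monoid_add"
  assumes "\<And>i. i \<in> I \<Longrightarrow> (f i has_sum s i) A"
  shows "((\<lambda>x. \<Sum>i\<in>I. f i x) has_sum (\<Sum>i\<in>I. s i)) A"
  using assms by (induction I rule: infinite_finite_induct) (auto intro: has_sum_add)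

lemma has_sum_tent:
  fixes x :: "real ^ 'n::{finite,linorder}"
  assumes r: "r > 0" and T: "T \<in> paths r" and x: "x \<in> cell r T"
  shows "((\<lambda>\<alpha>. w \<alpha> * tent r \<alpha> x) has_sum (\<Sum>i=0..CARD('n). w (T i) * bary r T i x)) (lattice_pts r)"
proof -
  have "((\<lambda>\<alpha>. \<Sum>i=0..CARD('n). w \<alpha> * (if T i = \<alpha> then bary r T i x else 0)) has_sum
      (\<Sum>i=0..CARD('n). w (T i) * bary r T i x)) (lattice_pts r)"
  proof (rule has_sum_sum)
    fix i assume "i \<in> {0..CARD('n)}"
    then show "((\<lambda>\<alpha>. w \<alpha> * (if T i = \<alpha> then bary r T i x else 0)) has_sum w (T i) * bary r T i x) (lattice_pts r)"
      using has_sum_single[of "lattice_pts r" "T i" "\<lambda>\<alpha>. w \<alpha> * (if T i = \<alpha> then bary r T i x else 0)"]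
        path_in_lattice[OF r T, of i] by auto
  qed
  then show ?thesis
    by (rule has_sum_cong[THEN iffD1, rotated]) (simp add: tent_on_cell[OF r T x] sum_distrib_left)
qed

lemma has_sum_tent_1:
  fixes x :: "real ^ 'n::{finite,linorder}"
  assumes "r > 0"
  shows "((\<lambda>\<alpha>. tent r \<alpha> x) has_sum 1) (lattice_pts r)"
  using has_sum_tent[OF assms cell_at[OF assms, of x], of "\<lambda>_. 1"] by (simp add: sum_bary)

subsection \<open>Local finiteness\<close>

lemma lattice_pts_image:
  "lattice_pts r = (\<lambda>k. \<chi> i. r * of_int (k i)) ` (UNIV :: ('n::finite \<Rightarrow> int) set)"
proof (intro set_eqI iffI)
  fix \<alpha> :: "real ^ 'n" assume "\<alpha> \<in> lattice_pts r"
  then obtain k where "\<And>i. \<alpha> $ i = r * of_int (k i)" unfolding lattice_pts_def by auto metis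
  then have "\<alpha> = (\<chi> i. r * of_int (k i))" by (simp add: vec_eq_iff)
  then show "\<alpha> \<in> (\<lambda>k. \<chi> i. r * of_int (k i)) ` UNIV" by blast
qed (auto simp: lattice_pts_def)

lemma countable_lattice_pts: "countable (lattice_pts r :: (real ^ 'n::finite) set)"
  unfolding lattice_pts_image by (intro countable_image) simp

lemma finite_lattice_pts_box:
  fixes a :: "real ^ 'n::finite"
  assumes "r > 0"
  shows "finite {\<alpha> \<in> lattice_pts r. \<forall>i. \<bar>\<alpha> $ i - a $ i\<bar> \<le> c}"
proof (rule finite_subset)
  let ?K = "(UNIV :: 'n set) \<rightarrow>\<^sub>E (\<Union>i. {\<lfloor>(a $ i - c) / r\<rfloor>..\<lceil>(a $ i + c) / r\<rceil>})"
  show "finite ((\<lambda>k. \<chi> i. r * of_int (k i) :: real ^ 'n) ` ?K)" by (intro finite_imageI finite_PiE) auto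
  show "{\<alpha> \<in> lattice_pts r. \<forall>i. \<bar>\<alpha> $ i - a $ i\<bar> \<le> c} \<subseteq> (\<lambda>k. \<chi> i. r * of_int (k i)) ` ?K"
  proof
    fix \<alpha> assume *: "\<alpha> \<in> {\<alpha> \<in> lattice_pts r. \<forall>i. \<bar>\<alpha> $ i - a $ i\<bar> \<le> c}"
    then obtain k where k: "\<alpha> = (\<chi> i. r * of_int (k i))" by (auto simp: lattice_pts_image)
    have "k i \<in> {\<lfloor>(a $ i - c) / r\<rfloor>..\<lceil>(a $ i + c) / r\<rceil>}" for i
    proof -
      have "\<bar>\<alpha> $ i - a $ i\<bar> \<le> c" using * by blast
      then have "\<bar>r * of_int (k i) - a $ i\<bar> \<le> c" by (simp add: k)
      then have "(a $ i - c) / r \<le> of_int (k i)" "of_int (k i) \<le> (a $ i + c) / r"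
        using assms by (auto simp: field_simps abs_le_iff)
      then show ?thesis by (auto simp: le_ceiling_iff floor_le_iff; linarith)
    qed
    then have "k \<in> ?K" by auto
    then show "\<alpha> \<in> (\<lambda>k. \<chi> i. r * of_int (k i)) ` ?K" using k by blast
  qed
qed

lemma ex_lipschitz_weighted_sum:
  assumes "\<And>\<alpha>. \<alpha> \<in> A \<Longrightarrow> C-lipschitz_on S (f \<alpha>)" "finite A"
  shows "\<exists>D. D-lipschitz_on S (\<lambda>x. \<Sum>\<alpha>\<in>A. w \<alpha> * f \<alpha> x :: real)"
  using assms(2,1)
proof (induction A)
  case empty
  then show ?case using lipschitz_on_constant by (intro exI[of _ 0]) simp
next
  case (insert \<alpha> A)
  then obtain D where "D-lipschitz_on S (\<lambda>x. \<Sum>\<alpha>\<in>A. w \<alpha> * f \<alpha> x)" by auto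
  then have "(\<bar>w \<alpha>\<bar> * C + D)-lipschitz_on S (\<lambda>x. w \<alpha> * f \<alpha> x + (\<Sum>\<alpha>\<in>A. w \<alpha> * f \<alpha> x))"
    using insert.prems by (intro lipschitz_on_add lipschitz_on_cmult_real) auto
  then show ?case using insert.hyps by (intro exI) simp
qed

lemma ex_lipschitz_tent_sum:
  fixes w :: "real ^ 'n::{finite,linorder} \<Rightarrow> real"
  assumes "r > 0"
  shows "\<exists>C. C-lipschitz_on (cball 0 R) (\<lambda>x. \<Sum>\<^sub>\<infinity>\<alpha>\<in>lattice_pts r. w \<alpha> * tent r \<alpha> x)"
proof -
  define A :: "(real ^ 'n::{finite,linorder}) set" where
    \<comment> \<open>A tent vanishes once some coordinate is at least \<open>r\<close> away from
      its node, so nodes with a coordinate beyond \<open>R + r\<close> do not reach the ball. The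
      index set is thus finite and the same for all points of the ball.\<close>
    "A = {\<alpha> \<in> lattice_pts r. \<forall>i. \<bar>\<alpha> $ i - (0 :: real ^ 'n::{finite,linorder}) $ i\<bar> \<le> R + r}"
  have A: "finite A" unfolding A_def by (rule finite_lattice_pts_box[OF assms])
  have eq: "(\<Sum>\<^sub>\<infinity>\<alpha>\<in>lattice_pts r. w \<alpha> * tent r \<alpha> x) = (\<Sum>\<alpha>\<in>A. w \<alpha> * tent r \<alpha> x)"
    if "x \<in> cball 0 R" for x
  proof (rule infsumI, rule has_sum_finite_neutralI[OF A])
    fix \<alpha> assume "\<alpha> \<in> lattice_pts r - A"
    then obtain i where "\<bar>\<alpha> $ i\<bar> > R + r" by (auto simp: A_def not_le)
    moreover have "\<bar>x $ i\<bar> \<le> R" using that component_le_norm_cart[of x i] by simp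
    ultimately have "r \<le> \<bar>x $ i - \<alpha> $ i\<bar>" by linarith
    then show "w \<alpha> * tent r \<alpha> x = 0" by (simp add: tent_eq_0[OF assms])
  qed (auto simp: A_def)
  obtain D where "D-lipschitz_on (cball 0 R) (\<lambda>x. \<Sum>\<alpha>\<in>A. w \<alpha> * tent r \<alpha> x)"
    using ex_lipschitz_weighted_sum[of A "2 / r" "cball 0 R" "tent r" w, OF tent_lipschitz[OF assms] A]
    by blast
  then have "D-lipschitz_on (cball 0 R) (\<lambda>x. \<Sum>\<^sub>\<infinity>\<alpha>\<in>lattice_pts r. w \<alpha> * tent r \<alpha> x)"
    by (rule lipschitz_on_transform) (rule eq)
  then show ?thesis ..
qed

subsection \<open>The integral of a tent function\<close>

text \<open>Cutting the support along translates of the cube \<open>Q\<close> and moving every piece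
  back to \<open>Q\<close> gives the integral over \<open>Q\<close> of a sum of translated tents.
  That sum is 1, so the volume of \<open>Q\<close> remains.\<close>

lemma has_bochner_integral_tent:
  fixes \<alpha> :: "real ^ 'n::{finite,linorder}"
  assumes r: "r > 0" and \<alpha>: "\<alpha> \<in> lattice_pts r"
  shows "has_bochner_integral lebesgue (tent r \<alpha>) (r ^ CARD('n))"
proof -
  define Q :: "(real ^ 'n::{finite,linorder}) set" where "Q = {x. \<forall>k. 0 \<le> x $ k \<and> x $ k < r}"
  have Q: "Q \<in> sets borel"
  proof -
    have "Q = (\<Inter>k. {x. 0 \<le> x $ k} \<inter> {x. x $ k < r})" by (auto simp: Q_def)
    also have "\<dots> \<in> sets borel"
      by (intro sets.finite_INT sets.Int borel_closed borel_open closed_Collect_le open_Collect_less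
          continuous_intros) auto
    finally show ?thesis .
  qed
  \<comment> \<open>The half-open cube lies between an open and a closed box of equal
    volume.\<close>
  have measure_Q: "measure lborel Q = r ^ CARD('n)"
  proof -
    define c :: "real ^ 'n::{finite,linorder}" where "c = (\<chi> k. r)"
    have "box 0 c \<subseteq> Q" "Q \<subseteq> cbox 0 c"
      by (auto simp: Q_def c_def mem_box_cart less_imp_le)
    then have "emeasure lborel (box 0 c) \<le> emeasure lborel Q" "emeasure lborel Q \<le> emeasure lborel (cbox 0 c)"
      using Q by (auto intro!: emeasure_mono)
    then have "emeasure lborel Q = emeasure lborel (cbox 0 c)"
      by (simp add: emeasure_lborel_box_eq emeasure_lborel_cbox_eq)
    moreover have "cbox 0 c \<noteq> {}" using r by (auto simp: c_def mem_box_cart intro!: exI[of _ 0] simp flip: ex_in_conv)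
    ultimately show ?thesis using content_cbox_cart[of 0 c] by (simp add: measure_def c_def)
  qed
  \<comment> \<open>Corners of all cubes on which the tent is nonzero somewhere: such a point is
    within \<open>r\<close> of the corner and within \<open>r\<close> of \<alpha> in every
    coordinate, whence \<open>2 * r\<close>.\<close>
  define S :: "(real ^ 'n::{finite,linorder}) set" where
    "S = {\<beta> \<in> lattice_pts r. \<forall>i. \<bar>\<beta> $ i - \<alpha> $ i\<bar> \<le> 2 * r}"
  have S: "finite S" unfolding S_def by (rule finite_lattice_pts_box[OF r])
  have int: "integrable lborel (tent r \<alpha>)"
  proof -
    have "bounded (cbox (\<alpha> - (\<chi> k. r)) (\<alpha> + (\<chi> k. r)))" by (rule bounded_cbox)
    then obtain R where R: "\<And>x. x \<in> cbox (\<alpha> - (\<chi> k. r)) (\<alpha> + (\<chi> k. r)) \<Longrightarrow> norm x \<le> R"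
      unfolding bounded_iff by blast
    show ?thesis
    proof (rule integrable_lborel_continuous_cball[OF continuous_on_tent[OF r]])
      fix x :: "real ^ 'n::{finite,linorder}" assume "norm x > R"
      then have "x \<notin> cbox (\<alpha> - (\<chi> k. r)) (\<alpha> + (\<chi> k. r))" using R[of x] by auto
      then obtain k where "\<not> (\<alpha> $ k - r \<le> x $ k \<and> x $ k \<le> \<alpha> $ k + r)" by (auto simp: mem_box_cart)
      then have "r \<le> \<bar>x $ k - \<alpha> $ k\<bar>" by linarith
      then show "tent r \<alpha> x = 0" by (rule tent_eq_0[OF r])
    qed
  qed
  have meas: "tent r \<alpha> \<in> borel_measurable borel" using int by simp
  have QS: "{x. x - \<beta> \<in> Q} \<in> sets borel" for \<beta>
  proof -
    have "(\<lambda>x. x - \<beta>) -` Q \<inter> space borel \<in> sets borel"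
      by (rule measurable_sets[OF _ Q]) simp
    then show ?thesis by (simp add: vimage_def)
  qed
  have tile: "tent r \<alpha> x = (\<Sum>\<beta>\<in>S. indicator {x. x - \<beta> \<in> Q} x * tent r \<alpha> x)" for x
  proof (cases "tent r \<alpha> x = 0")
    case False
    define \<beta>\<^sub>0 where "\<beta>\<^sub>0 = lattice_floor r x"
    have near: "\<bar>x $ k - \<alpha> $ k\<bar> < r" for k using tent_eq_0[OF r] False not_le by blast
    then have "\<bar>\<beta>\<^sub>0 $ k - \<alpha> $ k\<bar> \<le> 2 * r" for k
      using lattice_floor_bounds[OF r, of x k] near[of k] unfolding \<beta>\<^sub>0_def by linarith
    then have "\<beta>\<^sub>0 \<in> S" by (simp add: S_def \<beta>\<^sub>0_def lattice_floor_in_lattice)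
    moreover have "x - \<beta> \<in> Q \<longleftrightarrow> \<beta> = \<beta>\<^sub>0" if "\<beta> \<in> S" for \<beta>
    proof
      assume "x - \<beta> \<in> Q"
      then show "\<beta> = \<beta>\<^sub>0" unfolding \<beta>\<^sub>0_def
        using that by (intro lattice_floor_unique[OF r]) (auto simp: Q_def S_def)
    qed (use lattice_floor_bounds[OF r, of x] in \<open>simp add: Q_def \<beta>\<^sub>0_def\<close>)
    then have "(\<Sum>\<beta>\<in>S. indicator {x. x - \<beta> \<in> Q} x * tent r \<alpha> x) = (\<Sum>\<beta>\<in>S. if \<beta> = \<beta>\<^sub>0 then tent r \<alpha> x else 0)"
      by (intro sum.cong) auto
    ultimately show ?thesis using S by simp
  qed simp
  have shift: "tent r \<alpha> (x + \<beta>) = tent r (\<alpha> - \<beta>) x" for x \<beta>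
    by (simp add: tent_def algebra_simps)
  \<comment> \<open>The nodes \<alpha> - \<beta> include every node whose tent is nonzero somewhere
    on \<open>Q\<close>, so this finite sum is the whole partition of unity.\<close>
  have sum1: "(\<Sum>\<beta>\<in>S. tent r (\<alpha> - \<beta>) x) = 1" if x: "x \<in> Q" for x
  proof -
    have "inj_on (\<lambda>\<beta>. \<alpha> - \<beta>) S" by (simp add: inj_on_def)
    then have "(\<Sum>\<beta>\<in>S. tent r (\<alpha> - \<beta>) x) = (\<Sum>\<gamma>\<in>(\<lambda>\<beta>. \<alpha> - \<beta>) ` S. tent r \<gamma> x)"
      by (simp add: sum.reindex)
    moreover have "((\<lambda>\<gamma>. tent r \<gamma> x) has_sum (\<Sum>\<gamma>\<in>(\<lambda>\<beta>. \<alpha> - \<beta>) ` S. tent r \<gamma> x)) (lattice_pts r)"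
    proof (rule has_sum_finite_neutralI)
      show "(\<lambda>\<beta>. \<alpha> - \<beta>) ` S \<subseteq> lattice_pts r" using \<alpha> by (auto simp: S_def intro: lattice_pts_diff)
      fix \<gamma> assume \<gamma>: "\<gamma> \<in> lattice_pts r - (\<lambda>\<beta>. \<alpha> - \<beta>) ` S"
      have "\<gamma> = \<alpha> - (\<alpha> - \<gamma>)" by simp
      then have "\<alpha> - \<gamma> \<notin> S" using \<gamma> by blast
      then obtain k where "2 * r < \<bar>\<gamma> $ k\<bar>" using \<gamma> \<alpha> by (auto simp: S_def not_le lattice_pts_diff)
      moreover have "0 \<le> x $ k" "x $ k < r" using x by (auto simp: Q_def)
      ultimately have "r \<le> \<bar>x $ k - \<gamma> $ k\<bar>" by linarith
      then show "tent r \<gamma> x = 0" by (rule tent_eq_0[OF r])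
    qed (use S in auto)
    ultimately show ?thesis using has_sum_unique[OF _ has_sum_tent_1[OF r, of x]] by metis
  qed
  have "(LINT x|lborel. tent r \<alpha> x) = (LINT x|lborel. (\<Sum>\<beta>\<in>S. indicator {x. x - \<beta> \<in> Q} x * tent r \<alpha> x))"
    by (intro Bochner_Integration.integral_cong tile refl)
  also have "\<dots> = (\<Sum>\<beta>\<in>S. LINT x|lborel. indicator {x. x - \<beta> \<in> Q} x * tent r \<alpha> x)"
    using integrable_mult_indicator[OF _ int] QS by (intro Bochner_Integration.integral_sum) simp
  also have "\<dots> = (\<Sum>\<beta>\<in>S. LINT x|lborel. indicator Q x * tent r (\<alpha> - \<beta>) x)"
  proof (rule sum.cong[OF refl])
    fix \<beta>
    have "(\<lambda>x. indicator {x. x - \<beta> \<in> Q} x * tent r \<alpha> x) \<in> borel_measurable borel"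
      using QS meas by (intro borel_measurable_times borel_measurable_indicator) auto
    from integral_lborel_translation[OF this, of \<beta>]
    show "(LINT x|lborel. indicator {x. x - \<beta> \<in> Q} x * tent r \<alpha> x) =
        (LINT x|lborel. indicator Q x * tent r (\<alpha> - \<beta>) x)"
      by (simp add: shift indicator_def)
  qed
  also have "\<dots> = (LINT x|lborel. (\<Sum>\<beta>\<in>S. indicator Q x * tent r (\<alpha> - \<beta>) x))"
  proof (rule Bochner_Integration.integral_sum[symmetric])
    fix \<beta>
    have "integrable lborel (\<lambda>x. indicator Q x * 1 :: real)"
      using Q measure_Q r by (simp add: integrable_indicator_iff)
        (metis emeasure_eq_ennreal_measure ennreal_less_top measure_def
          enn2real_top less_irrefl top.not_eq_extremum zero_less_power)
    then show "integrable lborel (\<lambda>x. indicator Q x * tent r (\<alpha> - \<beta>) x)"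
    proof (rule Bochner_Integration.integrable_bound)
      show "(\<lambda>x. indicator Q x * tent r (\<alpha> - \<beta>) x) \<in> borel_measurable lborel"
        using Q continuous_on_tent[OF r]
        by (intro borel_measurable_times borel_measurable_indicator) (auto intro: borel_measurable_continuous_onI)
    qed (use tent_bounds[of r "\<alpha> - \<beta>"] in \<open>auto simp: indicator_def\<close>)
  qed
  also have "\<dots> = (LINT x|lborel. indicator Q x)"
    by (intro Bochner_Integration.integral_cong) (auto simp: sum_distrib_left[symmetric] sum1 indicator_def)
  also have "\<dots> = r ^ CARD('n)" using Q measure_Q by simp
  finally have "(LINT x|lborel. tent r \<alpha> x) = r ^ CARD('n)" .
  then show ?thesis
    using int meas by (simp add: has_bochner_integral_iff integrable_completion integral_completion)
qed

subsection \<open>Partial derivatives of sums of tent functions\<close>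

text \<open>Off the countably many hyperplanes on which a coordinate or a difference of two
  coordinates is an integer multiple of \<open>r\<close>, all inequalities of the cell hold
  strictly, which is an open condition.\<close>

lemma AE_interior_cell:
  assumes r: "r > 0"
  shows "AE x :: real ^ 'n::{finite,linorder} in lebesgue. x \<in> interior (cell r (cell_at r x))"
proof -
  define I :: "(real ^ 'n::{finite,linorder}) set" where
    "I = {axis i 1 | i. True} \<union> {axis i 1 - axis j 1 | i j. i \<noteq> j}"
  define N :: "(real ^ 'n::{finite,linorder}) set" where "N = (\<Union>a\<in>I. \<Union>m::int. {x. a \<bullet> x = r * of_int m})"
  have "I \<subseteq> (\<lambda>i. axis i 1) ` UNIV \<union> (\<lambda>(i, j). axis i 1 - axis j 1) ` UNIV"
    by (auto simp: I_def image_iff)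
  then have "countable I" by (rule countable_subset) (auto intro: countable_finite)
  moreover have "a \<noteq> 0" if "a \<in> I" for a
    using that by (auto simp: I_def axis_eq_0_iff axis_eq_axis)
  ultimately have "negligible N" unfolding N_def
    by (intro negligible_countable_Union countable_image) (auto intro!: negligible_countable_Union negligible_hyperplane)
  then have "AE x in lebesgue. x \<notin> N"
    by (intro AE_not_in) (simp add: negligible_iff_null_sets)
  then show ?thesis
  proof eventually_elim
    case (elim x)
    define T where "T = cell_at r x"
    have T: "T \<in> paths r" "x \<in> cell r T" using cell_at[OF r, of x] by (simp_all add: T_def)
    obtain \<beta> \<sigma> where \<beta>: "\<beta> \<in> lattice_pts r" and \<sigma>: "\<sigma> \<in> perms"
      and p: "path_parts r T = (\<beta>, unit_path \<sigma>)" using pathsE[OF r T(1)] by metis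
    have coord: "x $ i - \<beta> $ i \<noteq> 0" for i
    proof
      assume *: "x $ i - \<beta> $ i = 0"
      obtain m :: int where "\<beta> $ i = r * of_int m" using \<beta> by (auto simp: lattice_pts_def)
      with * have "axis i 1 \<bullet> x = r * of_int m" by (simp add: inner_axis')
      then show False using elim by (auto simp: N_def I_def)
    qed
    have diff: "x $ i - \<beta> $ i \<noteq> x $ j - \<beta> $ j" if "i \<noteq> j" for i j
    proof
      assume *: "x $ i - \<beta> $ i = x $ j - \<beta> $ j"
      obtain m l :: int where "\<beta> $ i = r * of_int m" "\<beta> $ j = r * of_int l"
        using \<beta> unfolding lattice_pts_def by blast
      with * have "(axis i 1 - axis j 1) \<bullet> x = r * of_int (m - l)"
        by (simp add: inner_axis' inner_diff_left algebra_simps)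
      then show False using elim that unfolding N_def I_def by blast
    qed
    define z where "z = (\<lambda>y. (y - \<beta>) /\<^sub>R r)"
    define V where "V = {y. 0 < z y $ \<sigma> CARD('n)} \<inter>
      (\<Inter>i\<in>{2..CARD('n)}. {y. z y $ \<sigma> i < z y $ \<sigma> (i - 1)}) \<inter> {y. z y $ \<sigma> 1 < 1}"
    have "open V"
      unfolding V_def z_def by (intro open_Int open_INT ballI open_Collect_less continuous_intros) auto
    moreover have "V \<subseteq> cell r T"
      unfolding V_def by (auto simp: mem_cell_iff[OF r p] unit_cell_iff_precedes[OF \<sigma>] precedes_def z_def)
    moreover have "x \<in> V"
    proof -
      have x: "z x \<in> unit_cell (unit_path \<sigma>)" using T(2) by (simp add: mem_cell_iff[OF r p] z_def)
      have "z x $ \<sigma> CARD('n) \<noteq> 0" using coord[of "\<sigma> CARD('n)"] r by (simp add: z_def)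
      moreover have "z x $ \<sigma> i \<noteq> z x $ \<sigma> (i - 1)" if i: "i \<in> {2..CARD('n)}" for i
      proof -
        obtain l where "i = Suc l" "l \<in> {1..CARD('n)}" using i by (cases i) auto
        then have "\<sigma> i \<noteq> \<sigma> (i - 1)" using i perms_eq_iff[OF \<sigma>, of l i] by auto
        then show ?thesis using diff[of "\<sigma> i" "\<sigma> (i - 1)"] r by (simp add: z_def)
      qed
      ultimately show ?thesis
        using x by (fastforce simp: V_def unit_cell_iff_precedes[OF \<sigma>] precedes_def)
    qed
    ultimately have "x \<in> interior (cell r T)" by (auto intro: interiorI)
    then show ?case by (simp add: T_def)
  qed
qed

text \<open>\<open>path_pos r T i\<close> is the step in which the path moves in direction
  \<open>i\<close>. The last claim later turns the weight at the end of that step into one at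
  \<alpha> + r e_i.\<close>

lemma path_pos_props:
  fixes T :: "nat \<Rightarrow> real ^ 'n::{finite,linorder}"
  assumes "r > 0" "T \<in> paths r"
  shows "path_pos r T i \<in> {1..CARD('n)}" "path_perm r T (path_pos r T i) = i"
    and "\<And>j. j \<in> {1..CARD('n)} \<Longrightarrow> path_perm r T j = i \<longleftrightarrow> j = path_pos r T i"
    and "bij_betw (path_perm r T) {1..CARD('n)} UNIV"
    and "T (path_pos r T i) = T (path_pos r T i - 1) + r *\<^sub>R axis i 1"
proof -
  obtain \<beta> \<sigma> where \<sigma>: "\<sigma> \<in> perms" "path_perm r T = \<sigma>"
    and Ti: "\<And>i. i \<le> CARD('n) \<Longrightarrow> T i = \<beta> + r *\<^sub>R unit_path \<sigma> i"
    using pathsE[OF assms] by metis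
  show b: "bij_betw (path_perm r T) {1..CARD('n)} UNIV" using perms_bij(1) \<sigma> by blast
  have im: "i \<in> path_perm r T ` {1..CARD('n)}" using b by (simp add: bij_betw_imp_surj_on)
  show pos: "path_pos r T i \<in> {1..CARD('n)}" using inv_into_into[OF im] by (simp add: path_pos_def)
  show perm: "path_perm r T (path_pos r T i) = i" using f_inv_into_f[OF im] by (simp add: path_pos_def)
  show "path_perm r T j = i \<longleftrightarrow> j = path_pos r T i" if "j \<in> {1..CARD('n)}" for j
    using perms_eq_iff[OF \<sigma>(1) that pos] perm \<sigma>(2) by auto
  show "T (path_pos r T i) = T (path_pos r T i - 1) + r *\<^sub>R axis i 1"
    using unit_path_step[OF pos, of \<sigma>] pos perm \<sigma>(2) Ti[of "path_pos r T i"] Ti[of "path_pos r T i - 1"]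
    by (auto simp: algebra_simps simp flip: scaleR_add_right)
qed

text \<open>A move in direction \<open>i\<close> changes only the coordinate at position p =
  \<open>path_pos r T i\<close>, which enters height p with sign plus and height p - 1 with sign
  minus.\<close>

lemma bary_shift:
  fixes T :: "nat \<Rightarrow> real ^ 'n::{finite,linorder}"
  assumes r: "r > 0" and T: "T \<in> paths r" and j: "j \<le> CARD('n)"
  shows "bary r T j (x + t *\<^sub>R axis i 1) = bary r T j x +
    t / r * ((if j = path_pos r T i then 1 else 0) - (if j = path_pos r T i - 1 then 1 else 0))"
proof -
  obtain \<beta> \<sigma> where \<sigma>: "\<sigma> \<in> perms" "path_perm r T = \<sigma>"
    and p: "path_parts r T = (\<beta>, unit_path \<sigma>)"
    using pathsE[OF r T] by metis
  define z where "z = (x - \<beta>) /\<^sub>R r"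
  have z: "((x + t *\<^sub>R axis i 1 - \<beta>) /\<^sub>R r) $ \<sigma> l = z $ \<sigma> l + (if l = path_pos r T i then t / r else 0)"
    if "l \<in> {1..CARD('n)}" for l
    using path_pos_props(3)[OF r T that, of i]
    by (auto simp: z_def \<sigma>(2) axis_def divide_inverse algebra_simps)
  have z': "((x - \<beta>) /\<^sub>R r) $ k = z $ k" for k by (simp add: z_def)
  have pos: "path_pos r T i \<in> {1..CARD('n)}" by (rule path_pos_props(1)[OF r T])
  consider "j = 0" | "j \<noteq> 0" "j < CARD('n)" | "j \<noteq> 0" "j = CARD('n)" using j by linarith
  then show ?thesis
  proof cases
    case 1
    then show ?thesis using pos z[of 1]
      by (auto simp: bary_def p height_def Let_def unit_perm_unit_path[OF \<sigma>(1)] z'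
          simp del: vector_scaleR_component vector_minus_component)
  next
    case 2
    then show ?thesis using pos z[of j] z[of "Suc j"]
      by (auto simp: bary_def p height_def Let_def unit_perm_unit_path[OF \<sigma>(1)] z'
          simp del: vector_scaleR_component vector_minus_component)
  next
    case 3
    then show ?thesis using pos z[of j]
      by (auto simp: bary_def p height_def Let_def unit_perm_unit_path[OF \<sigma>(1)] z'
          simp del: vector_scaleR_component vector_minus_component)
  qed
qed

text \<open>The slope of the interpolation along the edge of the cell parallel to axis
  \<open>i\<close>. It is defined on cell walls too, where it need not be a derivative.\<close>

definition tent_partial :: "
    real \<Rightarrow> (real ^ 'n::{finite,linorder} \<Rightarrow> real) \<Rightarrow> 'n::{finite,linorder} \<Rightarrow>
      real ^ 'n::{finite,linorder} \<Rightarrow> real" where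
  "tent_partial r w i x = (let T = cell_at r x; p = path_pos r T i in (w (T p) - w (T (p - 1))) / r)"

text \<open>For small t both points lie in one cell, on which the sum is affine, so the quotient is
  eventually constant.\<close>

lemma tent_sum_diff_quotient:
  fixes x :: "real ^ 'n::{finite,linorder}" and w :: "real ^ 'n::{finite,linorder} \<Rightarrow> real"
  assumes r: "r > 0" and x: "x \<in> interior (cell r (cell_at r x))"
  defines "F \<equiv> \<lambda>x. \<Sum>\<^sub>\<infinity>\<alpha>\<in>lattice_pts r. w \<alpha> * tent r \<alpha> x"
  shows "((\<lambda>t. (F (x + t *\<^sub>R axis i 1) - F x) / t) \<longlongrightarrow> tent_partial r w i x) (at 0)"
proof -
  define T where "T = cell_at r x"
  have T: "T \<in> paths r" "x \<in> cell r T" using cell_at[OF r, of x] by (simp_all add: T_def)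
  define p where "p = path_pos r T i"
  have p: "p \<in> {1..CARD('n)}" unfolding p_def by (rule path_pos_props(1)[OF r T(1)])
  have F: "F y = (\<Sum>j=0..CARD('n). w (T j) * bary r T j y)" if "y \<in> cell r T" for y
    unfolding F_def by (rule infsumI[OF has_sum_tent[OF r T(1) that]])
  have quot: "(F (x + t *\<^sub>R axis i 1) - F x) / t = tent_partial r w i x"
    if t: "t \<noteq> 0" "x + t *\<^sub>R axis i 1 \<in> cell r T" for t
  proof -
    have "F (x + t *\<^sub>R axis i 1) - F x =
        (\<Sum>j=0..CARD('n). t / r * ((if j = p then w (T j) else 0) - (if j = p - 1 then w (T j) else 0)))"
      unfolding F[OF t(2)] F[OF T(2)] sum_subtractf[symmetric]
      by (intro sum.cong refl, subst bary_shift[OF r T(1)]) (auto simp: p_def algebra_simps)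
    also have "\<dots> = t / r * (w (T p) - w (T (p - 1)))"
      using p unfolding sum_distrib_left[symmetric] sum_subtractf by auto
    finally show ?thesis using t by (simp add: tent_partial_def Let_def T_def p_def)
  qed
  have "((\<lambda>t. x + t *\<^sub>R axis i 1) \<longlongrightarrow> x + 0 *\<^sub>R axis i 1) (at 0)"
    by (intro tendsto_intros)
  then have "\<forall>\<^sub>F t in at 0. x + t *\<^sub>R axis i 1 \<in> interior (cell r T)"
    using x by (intro topological_tendstoD) (auto simp: T_def)
  then have "\<forall>\<^sub>F t in at 0. (F (x + t *\<^sub>R axis i 1) - F x) / t = tent_partial r w i x"
    unfolding eventually_at_filter by eventually_elim (use quot interior_subset in blast)
  then show ?thesis by (rule tendsto_eventually)
qed

text \<open>Leaving \<open>g\<close> free up to a null set makes this applicable to the sum of the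
  representatives chosen by \<open>weak_partial\<close>.\<close>

lemma has_weak_partial_tent_sum:
  fixes w :: "real ^ 'n::{finite,linorder} \<Rightarrow> real"
  assumes r: "r > 0" and g: "AE x in lebesgue. g x = tent_partial r w i x"
  shows "has_weak_partial i (\<lambda>x. \<Sum>\<^sub>\<infinity>\<alpha>\<in>lattice_pts r. w \<alpha> * tent r \<alpha> x) g"
proof (rule has_weak_partialI[OF ex_lipschitz_tent_sum[OF r]])
  show "AE x in lebesgue. ((\<lambda>t. ((\<Sum>\<^sub>\<infinity>\<alpha>\<in>lattice_pts r. w \<alpha> * tent r \<alpha> (x + t *\<^sub>R axis i 1)) -
      (\<Sum>\<^sub>\<infinity>\<alpha>\<in>lattice_pts r. w \<alpha> * tent r \<alpha> x)) / t) \<longlongrightarrow> g x) (at 0)"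
    using AE_interior_cell[OF r] g
    by eventually_elim (simp add: tent_sum_diff_quotient[OF r])
qed

text \<open>A single tent is the sum with weight 1 at its node and 0 elsewhere. Existence of a weak
  derivative validates the choice in \<open>weak_partial\<close>, and uniqueness identifies the
  chosen function.\<close>

lemma weak_partial_tent:
  fixes \<alpha> :: "real ^ 'n::{finite,linorder}"
  assumes r: "r > 0" and \<alpha>: "\<alpha> \<in> lattice_pts r"
  shows "AE x in lebesgue. weak_partial i (tent r \<alpha>) x = tent_partial r (\<lambda>\<gamma>. if \<gamma> = \<alpha> then 1 else 0) i x"
proof -
  have "(\<Sum>\<^sub>\<infinity>\<gamma>\<in>lattice_pts r. (if \<gamma> = \<alpha> then 1 else 0) * tent r \<gamma> x) = tent r \<alpha> x" for x
    using infsumI[OF has_sum_single[of "lattice_pts r" \<alpha> "\<lambda>\<gamma>. (if \<gamma> = \<alpha> then 1 else 0) * tent r \<gamma> x"]] \<alpha>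
    by simp
  then have g: "has_weak_partial i (tent r \<alpha>) (tent_partial r (\<lambda>\<gamma>. if \<gamma> = \<alpha> then 1 else 0) i)"
    using has_weak_partial_tent_sum[OF r, of _ "\<lambda>\<gamma>. if \<gamma> = \<alpha> then 1 else 0" i] by simp
  then have "has_weak_partial i (tent r \<alpha>) (weak_partial i (tent r \<alpha>))"
    unfolding weak_partial_def by (rule someI[of "has_weak_partial i (tent r \<alpha>)"])
  from this g show ?thesis by (rule has_weak_partial_unique)
qed

text \<open>Countability of the lattice gives a common null set for all nodes. Off it, every term
  can be replaced by the explicit slope of its tent.\<close>

lemma infsum_weak_partial_tent:
  assumes r: "r > 0"
  shows "AE x :: real ^ 'n::{finite,linorder} in lebesgue.
    (\<Sum>\<^sub>\<infinity>\<alpha>\<in>lattice_pts r. w \<alpha> * weak_partial i (tent r \<alpha>) x) = tent_partial r w i x"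
proof -
  have "AE x :: real ^ 'n::{finite,linorder} in lebesgue. \<forall>\<alpha>\<in>lattice_pts r.
      weak_partial i (tent r \<alpha>) x = tent_partial r (\<lambda>\<gamma>. if \<gamma> = \<alpha> then 1 else 0) i x"
    using weak_partial_tent[OF r] by (intro AE_ball_countable[THEN iffD2] countable_lattice_pts) auto
  then show ?thesis
  proof eventually_elim
    case (elim x)
    define T where "T = cell_at r x"
    have T: "T \<in> paths r" using cell_at[OF r, of x] by (simp add: T_def)
    define p where "p = path_pos r T i"
    have p: "p \<le> CARD('n)" "p - 1 \<le> CARD('n)"
      using path_pos_props(1)[OF r T, of i] by (auto simp: p_def)
    have single: "((\<lambda>\<alpha>. if T j = \<alpha> then w \<alpha> * c else 0) has_sum w (T j) * c) (lattice_pts r)"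
      if "j \<le> CARD('n)" for j c
      using has_sum_single[of "lattice_pts r" "T j" "\<lambda>\<alpha>. if T j = \<alpha> then w \<alpha> * c else 0"]
        path_in_lattice[OF r T that] by auto
    \<comment> \<open>Only the two ends of the edge in direction \<open>i\<close> contribute: that
      tent rises with slope 1/r towards its node \<open>T p\<close> and falls with slope -1/r away
      from \<open>T (p - 1)\<close>.\<close>
    have "((\<lambda>\<alpha>. (if T p = \<alpha> then w \<alpha> * (1 / r) else 0) + (if T (p - 1) = \<alpha> then w \<alpha> * (- 1 / r) else 0)) has_sum
        w (T p) * (1 / r) + w (T (p - 1)) * (- 1 / r)) (lattice_pts r)"
      by (intro has_sum_add single p)
    then have "((\<lambda>\<alpha>. w \<alpha> * weak_partial i (tent r \<alpha>) x) has_sum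
        w (T p) * (1 / r) + w (T (p - 1)) * (- 1 / r)) (lattice_pts r)"
      by (rule has_sum_cong[THEN iffD1, rotated])
        (use elim in \<open>auto simp: tent_partial_def Let_def T_def p_def\<close>)
    from infsumI[OF this] show ?case
      by (simp add: tent_partial_def Let_def diff_divide_distrib flip: T_def p_def)
  qed
qed

text \<open>At a given point a sum over cells has at most one nonzero term. The filter
  \<open>P\<close> accommodates the restricted inner sum of the derivative formula; the gradient
  formula uses it with \<open>True\<close>.\<close>

lemma infsum_cells:
  fixes x :: "real ^ 'n::{finite,linorder}"
  assumes r: "r > 0"
  shows "(\<Sum>\<^sub>\<infinity>T\<in>{T \<in> paths r. P T}. f T * indicator (cell r T) x) =
    (if P (cell_at r x) then f (cell_at r x) else 0 :: real)"
proof -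
  have "((\<lambda>T. f T * indicator (cell r T) x) has_sum
      (if cell_at r x \<in> {T \<in> paths r. P T} then f (cell_at r x) * indicator (cell r (cell_at r x)) x else 0))
      {T \<in> paths r. P T}"
    by (rule has_sum_single) (use cell_at_eq[OF r, of _ x] in auto)
  from infsumI[OF this] show ?thesis using cell_at[OF r, of x] by simp
qed

text \<open>Both sums reduce to one term: the cell of \<open>x\<close>, and as \<alpha> the start of
  its edge in direction \<open>i\<close>.\<close>

lemma tent_partial_eq:
  fixes x :: "real ^ 'n::{finite,linorder}"
  assumes r: "r > 0"
  shows "tent_partial r w i x = 1 / r * (\<Sum>\<^sub>\<infinity>\<alpha>\<in>lattice_pts r.
    \<Sum>\<^sub>\<infinity>T\<in>{T \<in> paths r. T (path_pos r T i - 1) = \<alpha>}.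
      (w (\<alpha> + r *\<^sub>R axis i 1) - w \<alpha>) * indicator (cell r T) x)"
proof -
  define T where "T = cell_at r x"
  have T: "T \<in> paths r" using cell_at[OF r, of x] by (simp add: T_def)
  define \<alpha>\<^sub>0 where "\<alpha>\<^sub>0 = T (path_pos r T i - 1)"
  have "\<alpha>\<^sub>0 \<in> lattice_pts r"
    using path_pos_props(1)[OF r T, of i] unfolding \<alpha>\<^sub>0_def by (intro path_in_lattice[OF r T]) auto
  moreover have "(\<Sum>\<^sub>\<infinity>T\<in>{T \<in> paths r. T (path_pos r T i - 1) = \<alpha>}.
      (w (\<alpha> + r *\<^sub>R axis i 1) - w \<alpha>) * indicator (cell r T) x) =
      (if \<alpha>\<^sub>0 = \<alpha> then w (\<alpha> + r *\<^sub>R axis i 1) - w \<alpha> else 0)" for \<alpha>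
    by (subst infsum_cells[OF r]) (simp add: \<alpha>\<^sub>0_def T_def)
  ultimately have "(\<Sum>\<^sub>\<infinity>\<alpha>\<in>lattice_pts r.
      \<Sum>\<^sub>\<infinity>T\<in>{T \<in> paths r. T (path_pos r T i - 1) = \<alpha>}.
        (w (\<alpha> + r *\<^sub>R axis i 1) - w \<alpha>) * indicator (cell r T) x) = w (\<alpha>\<^sub>0 + r *\<^sub>R axis i 1) - w \<alpha>\<^sub>0"
    using infsumI[OF has_sum_single[of "lattice_pts r" \<alpha>\<^sub>0
          "\<lambda>\<alpha>. if \<alpha>\<^sub>0 = \<alpha> then w (\<alpha> + r *\<^sub>R axis i 1) - w \<alpha> else 0"]] by simp
  then show ?thesis
    using path_pos_props(5)[OF r T, of i] by (simp add: tent_partial_def Let_def \<alpha>\<^sub>0_def flip: T_def)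
qed

text \<open>A path uses every direction exactly once, so the sum over directions is a sum over its
  steps.\<close>

lemma sum_tent_partial_squares:
  fixes x :: "real ^ 'n::{finite,linorder}"
  assumes r: "r > 0"
  shows "(\<Sum>i\<in>UNIV. (tent_partial r w i x)\<^sup>2) = 1 / r\<^sup>2 * (\<Sum>\<^sub>\<infinity>T\<in>paths r.
    indicator (cell r T) x * (\<Sum>i=1..CARD('n). (w (T i) - w (T (i - 1)))\<^sup>2))"
proof -
  define T where "T = cell_at r x"
  have T: "T \<in> paths r" using cell_at[OF r, of x] by (simp add: T_def)
  define s where "s T = (\<Sum>i=1..CARD('n). (w (T i) - w (T (i - 1)))\<^sup>2)" for T
  have "(\<Sum>i\<in>UNIV. (tent_partial r w i x)\<^sup>2) =
      (\<Sum>j=1..CARD('n). (tent_partial r w (path_perm r T j) x)\<^sup>2)"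
    by (rule sum.reindex_bij_betw[OF path_pos_props(4)[OF r T], symmetric])
  also have "\<dots> = (\<Sum>j=1..CARD('n). 1 / r\<^sup>2 * (w (T j) - w (T (j - 1)))\<^sup>2)"
  proof (rule sum.cong[OF refl])
    fix j assume "j \<in> {1..CARD('n)}"
    then have "path_pos r T (path_perm r T j) = j" using path_pos_props(3)[OF r T] by metis
    then show "(tent_partial r w (path_perm r T j) x)\<^sup>2 = 1 / r\<^sup>2 * (w (T j) - w (T (j - 1)))\<^sup>2"
      by (simp add: tent_partial_def Let_def power_divide flip: T_def)
  qed
  also have "\<dots> = 1 / r\<^sup>2 * s T" by (simp add: s_def sum_distrib_left)
  also have "s T = (\<Sum>\<^sub>\<infinity>T\<in>paths r. indicator (cell r T) x * s T)"
    using infsum_cells[OF r, where P = "\<lambda>_. True" and f = s and x = x]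
    by (simp add: mult.commute flip: T_def)
  finally show ?thesis unfolding s_def .
qed

theorem theorem2p1:
  fixes r :: real
  assumes "CARD('n::{finite,linorder}) \<ge> 2" and "r > 0"
  shows
    "partition_on (UNIV :: (real ^ 'n::{finite,linorder}) set) (cell r ` paths r) \<and>
     disjoint_family_on (cell r :: _ \<Rightarrow> (real ^ 'n::{finite,linorder}) set) (paths r) \<and>
     (\<forall>x :: real ^ 'n::{finite,linorder}. ((\<lambda>\<alpha>. tent r \<alpha> x) has_sum 1) (lattice_pts r)) \<and>
     (\<forall>\<alpha> \<in> lattice_pts r :: (real ^ 'n::{finite,linorder}) set.
        has_bochner_integral lebesgue (tent r \<alpha>) (r ^ CARD('n))) \<and>
     (\<forall>\<alpha> \<in> lattice_pts r :: (real ^ 'n::{finite,linorder}) set.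
        continuous_on UNIV (tent r \<alpha>) \<and>
        (\<forall>x. tent r \<alpha> x \<in> {0..1}) \<and>
        closure {x. tent r \<alpha> x \<noteq> 0} \<subseteq> {\<alpha> + y | y. \<forall>i. y $ i \<in> {-r..r}}) \<and>
     (\<forall>w :: real ^ 'n::{finite,linorder} \<Rightarrow> real.
        (\<forall>i.
           has_weak_partial i
             (\<lambda>x. \<Sum>\<^sub>\<infinity>\<alpha>\<in>lattice_pts r. w \<alpha> * tent r \<alpha> x)
             (\<lambda>x. \<Sum>\<^sub>\<infinity>\<alpha>\<in>lattice_pts r. w \<alpha> * weak_partial i (tent r \<alpha>) x) \<and>
           (AE x in lebesgue.
             (\<Sum>\<^sub>\<infinity>\<alpha>\<in>lattice_pts r. w \<alpha> * weak_partial i (tent r \<alpha>) x) =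
             1 / r * (\<Sum>\<^sub>\<infinity>\<alpha>\<in>lattice_pts r.
               \<Sum>\<^sub>\<infinity>T\<in>{T \<in> paths r. T (path_pos r T i - 1) = \<alpha>}.
                 (w (\<alpha> + r *\<^sub>R axis i 1) - w \<alpha>) * indicator (cell r T) x))) \<and>
        (AE x in lebesgue.
          (\<Sum>i\<in>UNIV. (\<Sum>\<^sub>\<infinity>\<alpha>\<in>lattice_pts r. w \<alpha> * weak_partial i (tent r \<alpha>) x)\<^sup>2) =
          1 / r\<^sup>2 * (\<Sum>\<^sub>\<infinity>T\<in>paths r.
            indicator (cell r T) x * (\<Sum>i=1..CARD('n). (w (T i) - w (T (i - 1)))\<^sup>2))))"
proof (intro conjI ballI allI)
  note r = \<open>r > 0\<close>
  fix w :: "real ^ 'n::{finite,linorder} \<Rightarrow> real" and i :: 'n and \<alpha> x :: "real ^ 'n::{finite,linorder}"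
  note AE_sum = infsum_weak_partial_tent[OF r, of w]
  show "partition_on (UNIV :: (real ^ 'n::{finite,linorder}) set) (cell r ` paths r)"
    "disjoint_family_on (cell r :: _ \<Rightarrow> (real ^ 'n::{finite,linorder}) set) (paths r)"
    by (rule partition_cells[OF r])+
  show "((\<lambda>\<alpha>. tent r \<alpha> x) has_sum 1) (lattice_pts r)" by (rule has_sum_tent_1[OF r])
  show "has_bochner_integral lebesgue (tent r \<alpha>) (r ^ CARD('n))" if "\<alpha> \<in> lattice_pts r"
    using r that by (rule has_bochner_integral_tent)
  show "continuous_on UNIV (tent r \<alpha>)" by (rule continuous_on_tent[OF r])
  show "tent r \<alpha> x \<in> {0..1}" by (simp add: tent_bounds)
  show "closure {x. tent r \<alpha> x \<noteq> 0} \<subseteq> {\<alpha> + y | y. \<forall>i. y $ i \<in> {-r..r}}" by (rule support_tent[OF r])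
  show "has_weak_partial i (\<lambda>x. \<Sum>\<^sub>\<infinity>\<alpha>\<in>lattice_pts r. w \<alpha> * tent r \<alpha> x)
      (\<lambda>x. \<Sum>\<^sub>\<infinity>\<alpha>\<in>lattice_pts r. w \<alpha> * weak_partial i (tent r \<alpha>) x)"
    by (rule has_weak_partial_tent_sum[OF r AE_sum])
  show "AE x in lebesgue. (\<Sum>\<^sub>\<infinity>\<alpha>\<in>lattice_pts r. w \<alpha> * weak_partial i (tent r \<alpha>) x) =
      1 / r * (\<Sum>\<^sub>\<infinity>\<alpha>\<in>lattice_pts r. \<Sum>\<^sub>\<infinity>T\<in>{T \<in> paths r. T (path_pos r T i - 1) = \<alpha>}.
        (w (\<alpha> + r *\<^sub>R axis i 1) - w \<alpha>) * indicator (cell r T) x)"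
    using AE_sum by eventually_elim (simp only: tent_partial_eq[OF r])
  \<comment> \<open>The null sets of all directions are merged before the squares are added.\<close>
  have "AE x in lebesgue. \<forall>i\<in>UNIV.
      (\<Sum>\<^sub>\<infinity>\<alpha>\<in>lattice_pts r. w \<alpha> * weak_partial i (tent r \<alpha>) x) = tent_partial r w i x"
    using AE_sum by (intro AE_finite_allI) auto
  then show "AE x in lebesgue.
      (\<Sum>i\<in>UNIV. (\<Sum>\<^sub>\<infinity>\<alpha>\<in>lattice_pts r. w \<alpha> * weak_partial i (tent r \<alpha>) x)\<^sup>2) =
      1 / r\<^sup>2 * (\<Sum>\<^sub>\<infinity>T\<in>paths r.
        indicator (cell r T) x * (\<Sum>i=1..CARD('n). (w (T i) - w (T (i - 1)))\<^sup>2))"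
    by eventually_elim (simp add: sum_tent_partial_squares[OF r])
qed

end
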